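(* Fix positive integers $p\le q$ with $\gcd(p,q)=1$ and $n\ge 1$. The analytic moduli space of germs at $0\in\mathbb{C}^2$ of quasi-homogeneous curves of type $(p,q,n)$, i.e. the set of analytic equivalence classes of such germs, is given as follows. (i) If $(p,q)=(1,1)$, it is $\dfrac{\mathrm{Symm}(\mathbb{P}^1_\Delta(n))}{PSL(2,\mathbb{C})}$: the assignment $[\lambda]\mapsto$ (analytic class of $C_\lambda$) is a well-defined bijection from this quotient onto the moduli space. (ii) If $p=1$ and $q>1$, it is $\mathbb{Z}_2\times\dfrac{\mathrm{Symm}(\mathbb{C}_\Delta(n))}{\mathrm{Aff}(\mathbb{C})}$: the assignment $(m,[\lambda])\mapsto$ (analytic class of $C_{m,\lambda}$) is a well-defined bijection onto the moduli space. (iii) If $1<p<q$, it is $\mathbb{Z}_2\times\mathbb{Z}_2\times\dfrac{\mathrm{Symm}(\mathbb{C}^*_\Delta(n))}{GL(1,\mathbb{C})}$: the assignment $(m,k,[\lambda])\mapsto$ (analytic class of $C_{m,k,\lambda}$) is a well-defined bijection onto the moduli space.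
   Context: Two germs of curves $C,C'$ at $0\in\mathbb{C}^2$ are analytically equivalent if there is a germ of biholomorphism $\Phi$ of $(\mathbb{C}^2,0)$ with $\Phi(C)=C'$. For a set $M$, $M_\Delta(n)=\{(x_1,\dots,x_n)\in M^n : x_i\ne x_j \text{ for } i\neq j\}$; the symmetric group $S_n$ acts on it by permuting coordinates and $\mathrm{Symm}(M_\Delta(n))$ is the quotient. If a group $G$ acts on $M$, it acts diagonally on $M_\Delta(n)$, and this action descends to $\mathrm{Symm}(M_\Delta(n))$; $[\lambda]$ denotes the class of $\lambda\in M_\Delta(n)$ in $\mathrm{Symm}(M_\Delta(n))/G$. Here $PSL(2,\mathbb{C})$ acts on $\mathbb{P}^1=\mathbb{C}\cup\{\infty\}$ by Möbius transformations, $\mathrm{Aff}(\mathbb{C})$ acts on $\mathbb{C}$ by $z\mapsto az+b$ ($a\ne0$), and $GL(1,\mathbb{C})$ acts on $\mathbb{C}^*$ by $z\mapsto az$ ($a\neq 0$). $\mathbb{Z}_2$ is identified with $\{0,1\}$. Normal forms: - Type $(1,1,n)$: for $\lambda\in\mathbb{P}^1_\Delta(n)$, $C_\lambda=\{f_\lambda=0\}$, where $f_\lambda(x,y)=\prod_{j=1}^n(y-\lambda_jx)$ if all $\lambda_j\neq\infty$, and $f_\lambda(x,y)=x\prod_{j\ne i}(y-\lambda_jx)$ if $\lambda_i=\infty$. - Type $(1,q,n)$, $q\ge2$: for $m\in\{0,1\}$ and $\lambda\in\mathbb{C}_\Delta(n)$, $C_{m,\lambda}=\{x^m\prod_{j=1}^n(y-\lambda_jx^q)=0\}$.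 - Type $(p,q,n)$, $2\le p<q$, $\gcd(p,q)=1$: for $m,k\in\{0,1\}$ and $\lambda\in\mathbb{C}^*_\Delta(n)$, $C_{m,k,\lambda}=\{x^my^k\prod_{j=1}^n(y^p-\lambda_jx^q)=0\}$. A germ of curve at $0\in\mathbb{C}^2$ is a quasi-homogeneous curve of type $(p,q,n)$ if, in some system of local holomorphic coordinates $(x,y)$ at $0$, it is equal to: $C_\lambda$ for some $\lambda\in\mathbb{P}^1_\Delta(n)$, when $(p,q)=(1,1)$; $C_{m,\lambda}$ for some $m\in\{0,1\}$ and $\lambda\in\mathbb{C}_\Delta(n)$, when $p=1$ and $q\ge2$; $C_{m,k,\lambda}$ for some $m,k\in\{0,1\}$ and $\lambda\in\mathbb{C}^*_\Delta(n)$, when $2\le p<q$. *)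

theory Defs
  imports "HOL-Analysis.Analysis" "HOL-Combinatorics.Permutations"
begin

section \<open>Germs of sets and of curves at the origin of the complex plane\<close>

definition germ0 :: "(complex \<times> complex) set \<Rightarrow> (complex \<times> complex) set set" where
  "germ0 A = {B. \<forall>\<^sub>F z in nhds 0. z \<in> A \<longleftrightarrow> z \<in> B}"

text \<open>Holomorphy on an open set of two complex variables is complex differentiability: the
  real derivative at each point is \<open>\<complex>\<close>-linear.\<close>

definition holo2_on :: "(complex \<times> complex \<Rightarrow> complex) \<Rightarrow> (complex \<times> complex) set \<Rightarrow> bool" where
  "holo2_on f U \<longleftrightarrow>
     open U \<and> (\<forall>z\<in>U. \<exists>a b. (f has_derivative (\<lambda>(u, v). a * u + b * v)) (at z))"

definition holo2_map_on ::
  "(complex \<times> complex \<Rightarrow> complex \<times> complex) \<Rightarrow> (complex \<times> complex) set \<Rightarrow> bool" where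
  "holo2_map_on \<Phi> U \<longleftrightarrow> holo2_on (\<lambda>z. fst (\<Phi> z)) U \<and> holo2_on (\<lambda>z. snd (\<Phi> z)) U"

text \<open>A representative \<open>\<Phi> : U \<rightarrow> V\<close> of a germ of biholomorphism fixing the origin.\<close>

definition local_biholo ::
  "(complex \<times> complex \<Rightarrow> complex \<times> complex) \<Rightarrow>
     (complex \<times> complex) set \<Rightarrow> (complex \<times> complex) set \<Rightarrow> bool" where
  "local_biholo \<Phi> U V \<longleftrightarrow>
     open U \<and> open V \<and> 0 \<in> U \<and> 0 \<in> V \<and> \<Phi> 0 = 0 \<and> bij_betw \<Phi> U V \<and>
     holo2_map_on \<Phi> U \<and> holo2_map_on (inv_into U \<Phi>) V"

text \<open>Some germ of biholomorphism \<open>\<Phi>\<close> satisfies \<open>\<Phi>(C) = C'\<close>; equivalently, \<open>C\<close> is given by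
  \<open>C'\<close> in the local coordinates \<open>(x, y) = \<Phi>\<close>.\<close>

definition germ_biholo ::
  "(complex \<times> complex) set set \<Rightarrow> (complex \<times> complex) set set \<Rightarrow> bool" where
  "germ_biholo C C' \<longleftrightarrow>
     (\<exists>\<Phi> U V A. local_biholo \<Phi> U V \<and> C = germ0 A \<and> C' = germ0 (\<Phi> ` (A \<inter> U)))"

definition curve_germs :: "(complex \<times> complex) set set set" where
  "curve_germs = {germ0 {z \<in> U. f z = 0} | f U.
     holo2_on f U \<and> 0 \<in> U \<and> f 0 = 0 \<and> \<not> (\<forall>\<^sub>F z in nhds 0. f z = 0)}"

definition analytic_equiv ::
  "((complex \<times> complex) set set \<times> (complex \<times> complex) set set) set" where
  "analytic_equiv = {(C, C'). C \<in> curve_germs \<and> C' \<in> curve_germs \<and> germ_biholo C C'}"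

abbreviation analytic_class ::
  "(complex \<times> complex) set set \<Rightarrow> (complex \<times> complex) set set set" where
  "analytic_class C \<equiv> analytic_equiv `` {C}"


section \<open>Symmetrized configuration spaces and their quotients\<close>

definition conf :: "'a set \<Rightarrow> nat \<Rightarrow> 'a list set" where
  "conf M n = {xs. length xs = n \<and> set xs \<subseteq> M \<and> distinct xs}"

definition perm_rel :: "'a set \<Rightarrow> nat \<Rightarrow> ('a list \<times> 'a list) set" where
  "perm_rel M n =
     {(xs, ys). xs \<in> conf M n \<and> (\<exists>\<sigma>. \<sigma> permutes {..<n} \<and> ys = permute_list \<sigma> xs)}"

definition Symm :: "'a set \<Rightarrow> nat \<Rightarrow> 'a list set set" where
  "Symm M n = conf M n // perm_rel M n"

text \<open>Here \<open>G\<close> is a group of transformations of \<open>M\<close>. It acts diagonally on tuples by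
  \<open>map g\<close>, hence on a class of tuples by taking the image.\<close>

definition orbit_rel :: "('a \<Rightarrow> 'a) set \<Rightarrow> 'a set \<Rightarrow> nat \<Rightarrow> ('a list set \<times> 'a list set) set" where
  "orbit_rel G M n = {(s, t). s \<in> Symm M n \<and> (\<exists>g\<in>G. t = map g ` s)}"

definition Symm_quot :: "('a \<Rightarrow> 'a) set \<Rightarrow> 'a set \<Rightarrow> nat \<Rightarrow> 'a list set set set" where
  "Symm_quot G M n = Symm M n // orbit_rel G M n"

definition conf_class :: "('a \<Rightarrow> 'a) set \<Rightarrow> 'a set \<Rightarrow> nat \<Rightarrow> 'a list \<Rightarrow> 'a list set set" where
  "conf_class G M n xs = orbit_rel G M n `` {perm_rel M n `` {xs}}"

datatype P1 = Fin complex | Infty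

fun moebius :: "complex \<Rightarrow> complex \<Rightarrow> complex \<Rightarrow> complex \<Rightarrow> P1 \<Rightarrow> P1" where
  "moebius a b c d (Fin z) = (if c * z + d = 0 then Infty else Fin ((a * z + b) / (c * z + d)))"
| "moebius a b c d Infty = (if c = 0 then Infty else Fin (a / c))"

text \<open>The three groups are given as the transformation groups through which they act; the action
  of \<open>PSL(2,\<complex>)\<close> on the projective line is faithful.\<close>

definition PSL2 :: "(P1 \<Rightarrow> P1) set" where
  "PSL2 = {moebius a b c d | a b c d. a * d - b * c = 1}"

definition Aff :: "(complex \<Rightarrow> complex) set" where
  "Aff = {\<lambda>z. a * z + b | a b. a \<noteq> 0}"

definition GL1 :: "(complex \<Rightarrow> complex) set" where
  "GL1 = {\<lambda>z. a * z | a. a \<noteq> 0}"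


section \<open>Normal forms and the moduli space\<close>

text \<open>The linear form attached to a slope. Since the entries of a configuration are distinct,
  at most one factor of the product below is \<open>x\<close>.\<close>

fun slope_form :: "P1 \<Rightarrow> complex \<Rightarrow> complex \<Rightarrow> complex" where
  "slope_form (Fin l) x y = y - l * x"
| "slope_form Infty x y = x"

definition C_11 :: "P1 list \<Rightarrow> (complex \<times> complex) set set" where
  "C_11 ls = germ0 {(x, y). (\<Prod>l\<leftarrow>ls. slope_form l x y) = 0}"

definition C_1q :: "nat \<Rightarrow> nat \<Rightarrow> complex list \<Rightarrow> (complex \<times> complex) set set" where
  "C_1q q m ls = germ0 {(x, y). x ^ m * (\<Prod>l\<leftarrow>ls. y - l * x ^ q) = 0}"

definition C_pq ::
  "nat \<Rightarrow> nat \<Rightarrow> nat \<Rightarrow> nat \<Rightarrow> complex list \<Rightarrow> (complex \<times> complex) set set" where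
  "C_pq p q m k ls = germ0 {(x, y). x ^ m * y ^ k * (\<Prod>l\<leftarrow>ls. y ^ p - l * x ^ q) = 0}"

definition qh_curves :: "nat \<Rightarrow> nat \<Rightarrow> nat \<Rightarrow> (complex \<times> complex) set set set" where
  "qh_curves p q n = {C \<in> curve_germs.
     (p = 1 \<and> q = 1 \<and> (\<exists>ls \<in> conf UNIV n. germ_biholo C (C_11 ls))) \<or>
     (p = 1 \<and> 2 \<le> q \<and> (\<exists>m \<in> {0, 1}. \<exists>ls \<in> conf UNIV n. germ_biholo C (C_1q q m ls))) \<or>
     (2 \<le> p \<and> p < q \<and> coprime p q \<and>
        (\<exists>m \<in> {0, 1}. \<exists>k \<in> {0, 1}. \<exists>ls \<in> conf (- {0}) n. germ_biholo C (C_pq p q m k ls)))}"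

definition qh_moduli :: "nat \<Rightarrow> nat \<Rightarrow> nat \<Rightarrow> (complex \<times> complex) set set set set" where
  "qh_moduli p q n = qh_curves p q n // analytic_equiv"


section \<open>The relations above are equivalence relations\<close>

lemma germ0_eq_iff: "germ0 A = germ0 B \<longleftrightarrow> (\<forall>\<^sub>F z in nhds 0. z \<in> A \<longleftrightarrow> z \<in> B)"
proof
  assume "germ0 A = germ0 B"
  moreover have "B \<in> germ0 B" by (simp add: germ0_def)
  ultimately show "\<forall>\<^sub>F z in nhds 0. z \<in> A \<longleftrightarrow> z \<in> B" by (auto simp: germ0_def)
next
  assume *: "\<forall>\<^sub>F z in nhds 0. z \<in> A \<longleftrightarrow> z \<in> B"
  show "germ0 A = germ0 B"
    unfolding germ0_def
  proof (intro Collect_cong iffI)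
    fix D assume "\<forall>\<^sub>F z in nhds 0. z \<in> A \<longleftrightarrow> z \<in> D"
    with * show "\<forall>\<^sub>F z in nhds 0. z \<in> B \<longleftrightarrow> z \<in> D" by eventually_elim auto
  next
    fix D assume "\<forall>\<^sub>F z in nhds 0. z \<in> B \<longleftrightarrow> z \<in> D"
    with * show "\<forall>\<^sub>F z in nhds 0. z \<in> A \<longleftrightarrow> z \<in> D" by eventually_elim auto
  qed
qed

lemma holo2_on_subset: "holo2_on f U \<Longrightarrow> open W \<Longrightarrow> W \<subseteq> U \<Longrightarrow> holo2_on f W"
  by (auto simp: holo2_on_def)

lemma holo2_on_cong:
  assumes "holo2_on f U" "\<And>z. z \<in> U \<Longrightarrow> f z = g z"
  shows "holo2_on g U"
  using assms unfolding holo2_on_def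
  by (metis has_derivative_transform_within_open)

lemma holo2_on_compose:
  assumes f: "holo2_on f V" and \<Phi>: "holo2_map_on \<Phi> U" and sub: "\<Phi> ` U \<subseteq> V"
  shows "holo2_on (\<lambda>z. f (\<Phi> z)) U"
  unfolding holo2_on_def
proof (intro conjI ballI)
  show "open U" using \<Phi> by (simp add: holo2_map_on_def holo2_on_def)
next
  fix z assume z: "z \<in> U"
  obtain a b where 1: "((\<lambda>z. fst (\<Phi> z)) has_derivative (\<lambda>(u, v). a * u + b * v)) (at z)"
    using \<Phi> z unfolding holo2_map_on_def holo2_on_def by blast
  obtain c d where 2: "((\<lambda>z. snd (\<Phi> z)) has_derivative (\<lambda>(u, v). c * u + d * v)) (at z)"
    using \<Phi> z unfolding holo2_map_on_def holo2_on_def by blast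
  have "\<Phi> z \<in> V" using z sub by auto
  then obtain s t where 3: "(f has_derivative (\<lambda>(u, v). s * u + t * v)) (at (\<Phi> z))"
    using f unfolding holo2_on_def by blast
  have "(\<Phi> has_derivative (\<lambda>w. ((\<lambda>(u, v). a * u + b * v) w, (\<lambda>(u, v). c * u + d * v) w))) (at z)"
    using has_derivative_Pair[OF 1 2] by simp
  from has_derivative_compose[OF this 3]
  have "((\<lambda>z. f (\<Phi> z)) has_derivative (\<lambda>(u, v). (s * a + t * c) * u + (s * b + t * d) * v)) (at z)"
    by (rule has_derivative_eq_rhs) (auto simp: algebra_simps)
  then show "\<exists>a b. ((\<lambda>z. f (\<Phi> z)) has_derivative (\<lambda>(u, v). a * u + b * v)) (at z)" by blast
qed

lemma holo2_map_on_compose: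
  "holo2_map_on \<Psi> V \<Longrightarrow> holo2_map_on \<Phi> U \<Longrightarrow> \<Phi> ` U \<subseteq> V \<Longrightarrow> holo2_map_on (\<lambda>z. \<Psi> (\<Phi> z)) U"
  using holo2_on_compose unfolding holo2_map_on_def[of \<Psi>] holo2_map_on_def[of "\<lambda>z. \<Psi> (\<Phi> z)"]
  by blast

lemma holo2_map_on_subset: "holo2_map_on f U \<Longrightarrow> open W \<Longrightarrow> W \<subseteq> U \<Longrightarrow> holo2_map_on f W"
  by (auto simp: holo2_map_on_def intro: holo2_on_subset)

lemma holo2_map_on_cong:
  assumes "holo2_map_on f U" "\<And>z. z \<in> U \<Longrightarrow> f z = g z"
  shows "holo2_map_on g U"
  using assms unfolding holo2_map_on_def by (auto intro: holo2_on_cong)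

lemma holo2_map_on_continuous:
  assumes "holo2_map_on f U" shows "continuous_on U f"
proof -
  have "continuous_on U (\<lambda>z. fst (f z))" "continuous_on U (\<lambda>z. snd (f z))"
    using assms unfolding holo2_map_on_def holo2_on_def
    by (metis continuous_at_imp_continuous_on has_derivative_continuous)+
  from continuous_on_Pair[OF this] show ?thesis by simp
qed

lemma holo2_map_on_id: "open U \<Longrightarrow> holo2_map_on (\<lambda>z. z) U"
  unfolding holo2_map_on_def holo2_on_def
proof (intro conjI ballI; assumption?)
  fix z :: "complex \<times> complex"
  show "\<exists>a b. ((\<lambda>z. fst z) has_derivative (\<lambda>(u, v). a * u + b * v)) (at z)"
    by (rule exI[of _ 1], rule exI[of _ 0])
       (auto intro!: derivative_eq_intros simp: split_def)
  show "\<exists>a b. ((\<lambda>z. snd z) has_derivative (\<lambda>(u, v). a * u + b * v)) (at z)"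
    by (rule exI[of _ 0], rule exI[of _ 1])
       (auto intro!: derivative_eq_intros simp: split_def)
qed

lemma local_biholo_I:
  assumes "open U" "open V" "0 \<in> U" "\<Phi> 0 = 0" "holo2_map_on \<Phi> U" "holo2_map_on \<Psi> V"
    "\<And>z. z \<in> U \<Longrightarrow> \<Phi> z \<in> V \<and> \<Psi> (\<Phi> z) = z" "\<And>z. z \<in> V \<Longrightarrow> \<Psi> z \<in> U \<and> \<Phi> (\<Psi> z) = z"
  shows "local_biholo \<Phi> U V"
proof -
  have bij: "bij_betw \<Phi> U V"
    by (rule bij_betw_byWitness[of _ \<Psi>]) (use assms in auto)
  have "\<Psi> z = inv_into U \<Phi> z" if "z \<in> V" for z
    using assms(8)[OF that] bij by (metis bij_betw_inv_into_left)
  then have "holo2_map_on (inv_into U \<Phi>) V"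
    using holo2_map_on_cong[OF assms(6)] by blast
  moreover have "0 \<in> V" using assms by metis
  ultimately show ?thesis using assms bij by (simp add: local_biholo_def)
qed

lemma local_biholo_inv:
  assumes "local_biholo \<Phi> U V"
  shows "local_biholo (inv_into U \<Phi>) V U"
proof -
  have bij: "bij_betw \<Phi> U V" using assms by (simp add: local_biholo_def)
  show ?thesis
  proof (rule local_biholo_I[of _ _ _ \<Phi>])
    show "inv_into U \<Phi> 0 = 0"
      using assms bij by (metis bij_betw_inv_into_left local_biholo_def)
  qed (use assms bij in \<open>auto simp: local_biholo_def bij_betw_inv_into_right
        bij_betw_inv_into_left bij_betwE bij_betwE[OF bij_betw_inv_into]\<close>)
qed

lemma eventually_local_biholo:
  assumes "local_biholo \<Phi> U V" "\<forall>\<^sub>F z in nhds 0. P z"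
  shows "\<forall>\<^sub>F z in nhds 0. z \<in> U \<and> P (\<Phi> z)"
proof -
  have "open U" "0 \<in> U" "\<Phi> 0 = 0" "continuous_on U \<Phi>"
    using assms(1) holo2_map_on_continuous by (auto simp: local_biholo_def)
  then have "isCont \<Phi> 0" by (simp add: continuous_on_eq_continuous_at)
  then have "filterlim \<Phi> (nhds 0) (nhds 0)"
    using \<open>\<Phi> 0 = 0\<close> by (metis isCont_def tendsto_at_iff_tendsto_nhds)
  then have "\<forall>\<^sub>F z in nhds 0. P (\<Phi> z)" using assms(2) by (simp add: filterlim_iff)
  moreover have "\<forall>\<^sub>F z in nhds 0. z \<in> U" using \<open>open U\<close> \<open>0 \<in> U\<close> by (rule eventually_nhds_in_open)
  ultimately show ?thesis by eventually_elim simp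
qed

lemma germ0_image_cong:
  assumes "local_biholo \<Phi> U V" "germ0 A = germ0 B"
  shows "germ0 (\<Phi> ` (A \<inter> U)) = germ0 (\<Phi> ` (B \<inter> U))"
proof -
  have bij: "bij_betw \<Phi> U V" and V: "open V" "0 \<in> V" using assms by (auto simp: local_biholo_def)
  have "\<forall>\<^sub>F z in nhds 0. z \<in> V \<and> (inv_into U \<Phi> z \<in> A \<longleftrightarrow> inv_into U \<Phi> z \<in> B)"
    by (rule eventually_local_biholo[OF local_biholo_inv[OF assms(1)]])
       (use assms(2) in \<open>simp add: germ0_eq_iff\<close>)
  then show ?thesis
    unfolding germ0_eq_iff
  proof eventually_elim
    case (elim z)
    have "z \<in> \<Phi> ` (D \<inter> U) \<longleftrightarrow> inv_into U \<Phi> z \<in> D" for D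
    proof
      assume "z \<in> \<Phi> ` (D \<inter> U)"
      then show "inv_into U \<Phi> z \<in> D" using bij by (auto simp: bij_betw_inv_into_left)
    next
      assume "inv_into U \<Phi> z \<in> D"
      moreover have "inv_into U \<Phi> z \<in> U" using elim bij bij_betwE[OF bij_betw_inv_into] by blast
      moreover have "\<Phi> (inv_into U \<Phi> z) = z" using elim bij by (simp add: bij_betw_inv_into_right)
      ultimately show "z \<in> \<Phi> ` (D \<inter> U)" by (metis IntI imageI)
    qed
    with elim show ?case by simp
  qed
qed

lemma germ_biholo_refl: "germ_biholo (germ0 A) (germ0 A)"
proof -
  have "local_biholo (\<lambda>z. z) UNIV UNIV"
    by (rule local_biholo_I[of _ _ _ "\<lambda>z. z"]) (auto intro: holo2_map_on_id)
  moreover have "germ0 A = germ0 ((\<lambda>z. z) ` (A \<inter> UNIV))" by simp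
  ultimately show ?thesis unfolding germ_biholo_def by blast
qed

lemma germ_biholo_sym:
  assumes "germ_biholo C C'" shows "germ_biholo C' C"
proof -
  obtain \<Phi> U V A where *: "local_biholo \<Phi> U V" "C = germ0 A" "C' = germ0 (\<Phi> ` (A \<inter> U))"
    using assms unfolding germ_biholo_def by blast
  have bij: "bij_betw \<Phi> U V" and U: "open U" "0 \<in> U" using * by (auto simp: local_biholo_def)
  have "inv_into U \<Phi> ` (\<Phi> ` (A \<inter> U) \<inter> V) = A \<inter> U"
    using bij by (force simp: bij_betw_inv_into_left bij_betwE image_iff)
  moreover have "germ0 A = germ0 (A \<inter> U)"
    unfolding germ0_eq_iff using eventually_nhds_in_open[OF U] by eventually_elim auto
  ultimately have "C = germ0 (inv_into U \<Phi> ` (\<Phi> ` (A \<inter> U) \<inter> V))" using * by simp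
  then show ?thesis using local_biholo_inv[OF *(1)] *(3) unfolding germ_biholo_def by blast
qed

lemma germ_biholo_trans:
  assumes "germ_biholo C C'" "germ_biholo C' C''" shows "germ_biholo C C''"
proof -
  obtain \<Phi> U V A where 1: "local_biholo \<Phi> U V" "C = germ0 A" "C' = germ0 (\<Phi> ` (A \<inter> U))"
    using assms unfolding germ_biholo_def by blast
  obtain \<Psi> U' V' B where 2: "local_biholo \<Psi> U' V'" "C' = germ0 B" "C'' = germ0 (\<Psi> ` (B \<inter> U'))"
    using assms unfolding germ_biholo_def by blast
  define \<Phi>i where "\<Phi>i = inv_into U \<Phi>"
  define \<Psi>i where "\<Psi>i = inv_into U' \<Psi>"
  note f1 = 1(1)[unfolded local_biholo_def, folded \<Phi>i_def]
  note f2 = 2(1)[unfolded local_biholo_def, folded \<Psi>i_def]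
  have i1: "\<And>z. z \<in> U \<Longrightarrow> \<Phi> z \<in> V \<and> \<Phi>i (\<Phi> z) = z" "\<And>z. z \<in> V \<Longrightarrow> \<Phi>i z \<in> U \<and> \<Phi> (\<Phi>i z) = z"
    using f1 unfolding \<Phi>i_def
    by (auto simp: bij_betw_inv_into_right bij_betw_inv_into_left bij_betwE
        bij_betwE[OF bij_betw_inv_into])
  have i2: "\<And>z. z \<in> U' \<Longrightarrow> \<Psi> z \<in> V' \<and> \<Psi>i (\<Psi> z) = z" "\<And>z. z \<in> V' \<Longrightarrow> \<Psi>i z \<in> U' \<and> \<Psi> (\<Psi>i z) = z"
    using f2 unfolding \<Psi>i_def
    by (auto simp: bij_betw_inv_into_right bij_betw_inv_into_left bij_betwE
        bij_betwE[OF bij_betw_inv_into])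
  define W where "W = U \<inter> \<Phi> -` U'"
  define W' where "W' = V' \<inter> \<Psi>i -` V"
  have oW: "open W" unfolding W_def
    using f1 f2 holo2_map_on_continuous continuous_open_preimage by blast
  have oW': "open W'" unfolding W'_def
    using f1 f2 holo2_map_on_continuous continuous_open_preimage by blast
  have "local_biholo (\<lambda>z. \<Psi> (\<Phi> z)) W W'"
  proof (rule local_biholo_I[of _ _ _ "\<lambda>z. \<Phi>i (\<Psi>i z)"])
    show "holo2_map_on (\<lambda>z. \<Psi> (\<Phi> z)) W"
      by (rule holo2_map_on_compose[of _ U'])
         (use f1 f2 oW in \<open>auto simp: W_def intro: holo2_map_on_subset\<close>)
    show "holo2_map_on (\<lambda>z. \<Phi>i (\<Psi>i z)) W'"
      by (rule holo2_map_on_compose[of _ V])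
         (use f1 f2 oW' in \<open>auto simp: W'_def intro: holo2_map_on_subset\<close>)
  qed (use oW oW' f1 f2 i1 i2 in \<open>auto simp: W_def W'_def\<close>)
  moreover have "C'' = germ0 ((\<lambda>z. \<Psi> (\<Phi> z)) ` (A \<inter> W))"
  proof -
    have "C'' = germ0 (\<Psi> ` (\<Phi> ` (A \<inter> U) \<inter> U'))"
      using germ0_image_cong[OF 2(1), of B "\<Phi> ` (A \<inter> U)"] 1(3) 2(2,3) by simp
    also have "\<Psi> ` (\<Phi> ` (A \<inter> U) \<inter> U') = (\<lambda>z. \<Psi> (\<Phi> z)) ` (A \<inter> W)"
      by (auto simp: W_def)
    finally show ?thesis .
  qed
  ultimately show ?thesis using 1(2) unfolding germ_biholo_def by blast
qed

lemma equiv_analytic_equiv: "equiv curve_germs analytic_equiv"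
proof (rule equivI)
  show "analytic_equiv \<subseteq> curve_germs \<times> curve_germs" by (auto simp: analytic_equiv_def)
  show "refl_on curve_germs analytic_equiv"
    by (auto simp: refl_on_def analytic_equiv_def curve_germs_def intro: germ_biholo_refl)
  show "sym analytic_equiv"
    by (auto simp: sym_def analytic_equiv_def intro: germ_biholo_sym)
  show "trans analytic_equiv"
    unfolding trans_def analytic_equiv_def by (auto intro: germ_biholo_trans)
qed

lemma perm_rel_altdef:
  "perm_rel M n = {(xs, ys). xs \<in> conf M n \<and> ys \<in> conf M n \<and> set xs = set ys}"
proof (intro set_eqI iffI)
  fix z assume "z \<in> perm_rel M n"
  then show "z \<in> {(xs, ys). xs \<in> conf M n \<and> ys \<in> conf M n \<and> set xs = set ys}"
    by (auto simp: perm_rel_def conf_def)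
next
  fix z assume "z \<in> {(xs, ys). xs \<in> conf M n \<and> ys \<in> conf M n \<and> set xs = set ys}"
  then obtain xs ys where z: "z = (xs, ys)" "xs \<in> conf M n" "ys \<in> conf M n" "set xs = set ys"
    by auto
  then have "mset ys = mset xs" by (simp add: conf_def set_eq_iff_mset_eq_distinct)
  then obtain \<sigma> where "\<sigma> permutes {..<length xs}" "permute_list \<sigma> xs = ys"
    by (rule mset_eq_permutation)
  with z show "z \<in> perm_rel M n" by (auto simp: perm_rel_def conf_def)
qed

lemma equiv_perm_rel: "equiv (conf M n) (perm_rel M n)"
  by (rule equivI) (auto simp: perm_rel_altdef refl_on_def sym_def trans_def)

lemma map_image_perm_class:
  assumes g: "\<And>z. z \<in> M \<Longrightarrow> g z \<in> M" "inj_on g M" and xs: "xs \<in> conf M n"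
  shows "map g xs \<in> conf M n" "map g ` (perm_rel M n `` {xs}) = perm_rel M n `` {map g xs}"
proof -
  show gxs: "map g xs \<in> conf M n"
    using assms by (auto simp: conf_def distinct_map intro: inj_on_subset)
  show "map g ` (perm_rel M n `` {xs}) = perm_rel M n `` {map g xs}"
  proof (intro set_eqI iffI)
    fix ys assume "ys \<in> map g ` (perm_rel M n `` {xs})"
    then obtain \<sigma> where "\<sigma> permutes {..<n}" "ys = map g (permute_list \<sigma> xs)"
      by (auto simp: perm_rel_def)
    then show "ys \<in> perm_rel M n `` {map g xs}"
      using gxs xs permute_list_map[of \<sigma> xs g] by (auto simp: perm_rel_def conf_def)
  next
    fix ys assume "ys \<in> perm_rel M n `` {map g xs}"
    then obtain \<sigma> where "\<sigma> permutes {..<n}" "ys = permute_list \<sigma> (map g xs)"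
      by (auto simp: perm_rel_def)
    then show "ys \<in> map g ` (perm_rel M n `` {xs})"
      using xs permute_list_map[of \<sigma> xs g] by (auto simp: perm_rel_def conf_def)
  qed
qed

lemma equiv_orbit_rel:
  assumes M: "\<And>g z. g \<in> G \<Longrightarrow> z \<in> M \<Longrightarrow> g z \<in> M"
    and id: "(\<lambda>z. z) \<in> G" and comp: "\<And>g h. g \<in> G \<Longrightarrow> h \<in> G \<Longrightarrow> (\<lambda>z. g (h z)) \<in> G"
    and inv: "\<And>g. g \<in> G \<Longrightarrow> \<exists>h\<in>G. \<forall>z. h (g z) = z"
  shows "equiv (Symm M n) (orbit_rel G M n)"
proof (rule equivI)
  have inj: "inj_on g A" if "g \<in> G" for g A
    using inv[OF that] by (metis inj_onI)
  have cl: "map g ` s \<in> Symm M n" if g: "g \<in> G" and s: "s \<in> Symm M n" for g s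
  proof -
    obtain xs where xs: "xs \<in> conf M n" "s = perm_rel M n `` {xs}"
      using s by (auto simp: Symm_def quotient_def)
    have "map g xs \<in> conf M n" "map g ` s = perm_rel M n `` {map g xs}"
      using map_image_perm_class[of M g xs n] M inj g xs by auto
    then show ?thesis by (auto simp: Symm_def intro: quotientI)
  qed
  show "orbit_rel G M n \<subseteq> Symm M n \<times> Symm M n" by (auto simp: orbit_rel_def cl)
  show "refl_on (Symm M n) (orbit_rel G M n)"
    using id by (auto simp: refl_on_def orbit_rel_def intro!: bexI[of _ "\<lambda>z. z"])
  show "sym (orbit_rel G M n)"
  proof (rule symI)
    fix s t assume "(s, t) \<in> orbit_rel G M n"
    then obtain g where g: "s \<in> Symm M n" "g \<in> G" "t = map g ` s" by (auto simp: orbit_rel_def)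
    obtain h where h: "h \<in> G" "\<forall>z. h (g z) = z" using inv g by blast
    have "map h ` t = s" using g h by (simp add: image_image o_def)
    then show "(t, s) \<in> orbit_rel G M n" using g h cl by (auto simp: orbit_rel_def)
  qed
  show "trans (orbit_rel G M n)"
  proof (rule transI)
    fix s t u assume "(s, t) \<in> orbit_rel G M n" "(t, u) \<in> orbit_rel G M n"
    then obtain g h where *: "s \<in> Symm M n" "g \<in> G" "h \<in> G" "t = map g ` s" "u = map h ` t"
      by (auto simp: orbit_rel_def)
    then have "u = map (\<lambda>z. h (g z)) ` s" by (simp add: image_image o_def)
    then show "(s, u) \<in> orbit_rel G M n" using * comp by (auto simp: orbit_rel_def)
  qed
qed

lemma moebius_id: "moebius 1 0 0 1 = (\<lambda>z. z)"
proof
  fix z show "moebius 1 0 0 1 z = z" by (cases z) auto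
qed

lemma moebius_compose:
  assumes "a * d - b * c = 1" "a' * d' - b' * c' = 1"
  shows "moebius a b c d (moebius a' b' c' d' z) =
    moebius (a * a' + b * c') (a * b' + b * d') (c * a' + d * c') (c * b' + d * d') z"
proof (cases z)
  case (Fin w)
  define u v where "u = a' * w + b'" and "v = c' * w + d'"
  have e: "(c * a' + d * c') * w + (c * b' + d * d') = c * u + d * v"
    "(a * a' + b * c') * w + (a * b' + b * d') = a * u + b * v"
    by (simp_all add: u_def v_def algebra_simps)
  show ?thesis
  proof (cases "v = 0")
    case True
    have "u \<noteq> 0"
    proof
      assume "u = 0"
      have "a' * v - c' * u = 1" using assms(2) by (simp add: u_def v_def algebra_simps)
      with True \<open>u = 0\<close> show False by simp
    qed
    then show ?thesis using True Fin e by (simp add: u_def v_def)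
  next
    case False
    then have "c * (u / v) + d = (c * u + d * v) / v" "a * (u / v) + b = (a * u + b * v) / v"
      by (simp_all add: field_simps)
    with False show ?thesis using Fin e by (simp add: u_def[symmetric] v_def[symmetric])
  qed
next
  case Infty
  show ?thesis
  proof (cases "c' = 0")
    case True
    then have "a' \<noteq> 0" using assms by auto
    then show ?thesis using True Infty by simp
  next
    case False
    then have "c * (a' / c') + d = (c * a' + d * c') / c'" "a * (a' / c') + b = (a * a' + b * c') / c'"
      by (simp_all add: field_simps)
    with False show ?thesis using Infty by simp
  qed
qed

lemma equiv_orbit_rel_PSL2: "equiv (Symm UNIV n) (orbit_rel PSL2 UNIV n)"
proof (rule equiv_orbit_rel)
  show "(\<lambda>z. z) \<in> PSL2"
    unfolding PSL2_def moebius_id[symmetric] by force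
next
  fix g h assume "g \<in> PSL2" "h \<in> PSL2"
  then obtain a b c d a' b' c' d' where
    *: "a * d - b * c = 1" "g = moebius a b c d" "a' * d' - b' * c' = 1" "h = moebius a' b' c' d'"
    by (auto simp: PSL2_def)
  have "(\<lambda>z. g (h z)) =
      moebius (a * a' + b * c') (a * b' + b * d') (c * a' + d * c') (c * b' + d * d')"
    using * moebius_compose by auto
  moreover have "(a * a' + b * c') * (c * b' + d * d') - (a * b' + b * d') * (c * a' + d * c')
      = (a * d - b * c) * (a' * d' - b' * c')"
    by (simp add: algebra_simps)
  ultimately show "(\<lambda>z. g (h z)) \<in> PSL2" using * unfolding PSL2_def by auto
next
  fix g assume "g \<in> PSL2"
  then obtain a b c d where *: "a * d - b * c = 1" "g = moebius a b c d" by (auto simp: PSL2_def)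
  have i: "d * a - (- b) * (- c) = 1" using *(1) by (simp add: algebra_simps)
  have "moebius d (- b) (- c) a (g z) = z" for z
  proof -
    have "moebius d (- b) (- c) a (g z) = moebius 1 0 0 1 z"
      using * moebius_compose[OF i *(1)] by (simp add: algebra_simps)
    then show ?thesis by (simp add: moebius_id)
  qed
  then show "\<exists>h\<in>PSL2. \<forall>z. h (g z) = z" using i unfolding PSL2_def by blast
qed auto

lemma equiv_orbit_rel_Aff: "equiv (Symm UNIV n) (orbit_rel Aff UNIV n)"
proof (rule equiv_orbit_rel)
  show "(\<lambda>z. z) \<in> Aff"
    unfolding Aff_def by (rule CollectI, rule exI[of _ 1], rule exI[of _ 0]) simp
next
  fix g h assume "g \<in> Aff" "h \<in> Aff"
  then obtain a b c d where "g = (\<lambda>z. a * z + b)" "h = (\<lambda>z. c * z + d)" "a \<noteq> 0" "c \<noteq> 0"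
    by (auto simp: Aff_def)
  then show "(\<lambda>z. g (h z)) \<in> Aff"
    unfolding Aff_def
    by (intro CollectI exI[of _ "a * c"] exI[of _ "a * d + b"]) (auto simp: algebra_simps)
next
  fix g assume "g \<in> Aff"
  then obtain a b where *: "g = (\<lambda>z. a * z + b)" "a \<noteq> 0" by (auto simp: Aff_def)
  then have "\<forall>z. inverse a * g z + (- b / a) = z" by (auto simp: field_simps)
  moreover have "(\<lambda>z. inverse a * z + (- b / a)) \<in> Aff"
    unfolding Aff_def
    by (intro CollectI exI[of _ "inverse a"] exI[of _ "- b / a"]) (use * in auto)
  ultimately show "\<exists>h\<in>Aff. \<forall>z. h (g z) = z"
    by (intro bexI[of _ "\<lambda>z. inverse a * z + (- b / a)"])
qed auto

lemma equiv_orbit_rel_GL1: "equiv (Symm (- {0}) n) (orbit_rel GL1 (- {0}) n)"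
proof (rule equiv_orbit_rel)
  show "(\<lambda>z. z) \<in> GL1"
    unfolding GL1_def by (rule CollectI, rule exI[of _ 1]) (simp add: fun_eq_iff)
next
  fix g h assume "g \<in> GL1" "h \<in> GL1"
  then obtain a c where "g = (\<lambda>z. a * z)" "h = (\<lambda>z. c * z)" "a \<noteq> 0" "c \<noteq> 0"
    by (auto simp: GL1_def)
  then show "(\<lambda>z. g (h z)) \<in> GL1"
    unfolding GL1_def by (intro CollectI exI[of _ "a * c"]) (auto simp: algebra_simps)
next
  fix g assume "g \<in> GL1"
  then obtain a where *: "g = (\<lambda>z. a * z)" "a \<noteq> 0" by (auto simp: GL1_def)
  then have "\<forall>z. inverse a * g z = z" by (auto simp: field_simps)
  moreover have "(\<lambda>z. inverse a * z) \<in> GL1" using * unfolding GL1_def by auto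
  ultimately show "\<exists>h\<in>GL1. \<forall>z. h (g z) = z"
    by (intro bexI[of _ "\<lambda>z. inverse a * z"])
qed (auto simp: GL1_def)

end

theory Submission
  imports Defs "HOL-Complex_Analysis.Complex_Analysis"
begin

text \<open>Let \<open>\<Phi> = (f, g)\<close> be a biholomorphism between two normal forms, with matrix
  \<open>(a, b; c, d)\<close> of \<open>D\<Phi>(0)\<close>. Along the branch \<open>t \<mapsto> (t\<^sup>p, \<mu> t\<^sup>q)\<close>, \<open>\<mu>\<^sup>p = \<lambda>\<close>, the defining product of the
  target vanishes, so some factor vanishes for arbitrarily small \<open>t\<close>; for the factor
  \<open>y\<^sup>p - \<lambda>' x\<^sup>q\<close>, comparison of orders gives \<open>c = 0\<close> and, in the limit,
  \<open>(L + d \<mu>)\<^sup>p = \<lambda>' a\<^sup>q\<close> where \<open>L = lim g(t\<^sup>p, 0) / t\<^sup>q\<close> does not depend on the branch. The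
  order of \<open>g(t\<^sup>p, 0)\<close> is a multiple of \<open>p\<close>, so \<open>L = 0\<close> unless \<open>p = 1\<close>; hence
  \<open>\<lambda>' = (d\<^sup>p / a\<^sup>q) \<lambda>\<close> for \<open>p > 1\<close>, and \<open>\<lambda>' = (d \<lambda> + L) / a\<^sup>q\<close> for \<open>p = 1 < q\<close>. A vanishing factor
  \<open>x\<close> or \<open>y\<close> is treated as the case \<open>\<lambda>' = 0\<close> of the same computation. For lines only \<open>D\<Phi>(0)\<close>
  matters, and it acts on slopes by a Moebius transformation.\<close>

section \<open>Holomorphic functions of two variables\<close>

lemma holo2_on_const: "open U \<Longrightarrow> holo2_on (\<lambda>z. c) U"
  unfolding holo2_on_def
proof (intro conjI ballI; assumption?)
  fix z :: "complex \<times> complex"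
  show "\<exists>a b. ((\<lambda>z. c) has_derivative (\<lambda>(u, v). a * u + b * v)) (at z)"
    by (rule exI[of _ 0], rule exI[of _ 0]) (auto intro!: derivative_eq_intros simp: split_def)
qed

lemma holo2_on_fst: "open U \<Longrightarrow> holo2_on fst U"
  and holo2_on_snd: "open U \<Longrightarrow> holo2_on snd U"
  using holo2_map_on_id[of U] by (simp_all add: holo2_map_on_def)

lemma holo2_on_add:
  assumes "holo2_on f U" "holo2_on g U"
  shows "holo2_on (\<lambda>z. f z + g z) U"
  unfolding holo2_on_def
proof (intro conjI ballI)
  show "open U" using assms by (simp add: holo2_on_def)
  fix z assume "z \<in> U"
  then obtain a b c d where "(f has_derivative (\<lambda>(u, v). a * u + b * v)) (at z)"
    "(g has_derivative (\<lambda>(u, v). c * u + d * v)) (at z)"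
    using assms unfolding holo2_on_def by blast
  from has_derivative_add[OF this]
  have "((\<lambda>z. f z + g z) has_derivative (\<lambda>(u, v). (a + c) * u + (b + d) * v)) (at z)"
    by (rule has_derivative_eq_rhs) (auto simp: algebra_simps)
  then show "\<exists>a b. ((\<lambda>z. f z + g z) has_derivative (\<lambda>(u, v). a * u + b * v)) (at z)" by blast
qed

lemma holo2_on_mult:
  assumes "holo2_on f U" "holo2_on g U"
  shows "holo2_on (\<lambda>z. f z * g z) U"
  unfolding holo2_on_def
proof (intro conjI ballI)
  show "open U" using assms by (simp add: holo2_on_def)
  fix z assume "z \<in> U"
  then obtain a b c d where "(f has_derivative (\<lambda>(u, v). a * u + b * v)) (at z)"
    "(g has_derivative (\<lambda>(u, v). c * u + d * v)) (at z)"
    using assms unfolding holo2_on_def by blast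
  from has_derivative_mult[OF this]
  have "((\<lambda>z. f z * g z) has_derivative
      (\<lambda>(u, v). (f z * c + a * g z) * u + (f z * d + b * g z) * v)) (at z)"
    by (rule has_derivative_eq_rhs) (auto simp: algebra_simps)
  then show "\<exists>a b. ((\<lambda>z. f z * g z) has_derivative (\<lambda>(u, v). a * u + b * v)) (at z)" by blast
qed

lemma holo2_on_diff:
  assumes "holo2_on f U" "holo2_on g U"
  shows "holo2_on (\<lambda>z. f z - g z) U"
proof -
  have "open U" using assms by (simp add: holo2_on_def)
  then have "holo2_on (\<lambda>z. f z + (- 1) * g z) U"
    by (intro holo2_on_add holo2_on_mult holo2_on_const assms)
  then show ?thesis by simp
qed

lemma holo2_on_power: "holo2_on f U \<Longrightarrow> holo2_on (\<lambda>z. f z ^ n) U"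
  by (induction n) (auto simp: holo2_on_def[of f] intro: holo2_on_const holo2_on_mult)

lemma holo2_on_prod_list:
  assumes "open U" "\<And>l. l \<in> set ls \<Longrightarrow> holo2_on (f l) U"
  shows "holo2_on (\<lambda>z. \<Prod>l\<leftarrow>ls. f l z) U"
  using assms(2) by (induction ls) (auto intro: holo2_on_const holo2_on_mult assms(1))

lemmas holo2_on_intros = holo2_on_const holo2_on_fst holo2_on_snd holo2_on_add holo2_on_mult
  holo2_on_diff holo2_on_power holo2_on_prod_list

lemma holo2_on_imp_continuous_on: "holo2_on f U \<Longrightarrow> continuous_on U f"
  unfolding holo2_on_def
  by (metis continuous_at_imp_continuous_on has_derivative_continuous)

section \<open>Slices and strict differentiability in the second variable\<close>

lemma has_derivative_fst_slice:
  assumes "(f has_derivative (\<lambda>(u, v). a * u + b * v)) (at (x, y))"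
  shows "((\<lambda>x. f (x, y)) has_field_derivative a) (at x)"
proof -
  have 1: "((\<lambda>x. (x, y)) has_derivative (\<lambda>u. (u, 0))) (at x)"
    by (auto intro!: derivative_eq_intros)
  from has_derivative_compose[OF 1 assms] show ?thesis
    by (simp add: has_field_derivative_def)
qed

lemma has_derivative_snd_slice:
  assumes "(f has_derivative (\<lambda>(u, v). a * u + b * v)) (at (x, y))"
  shows "((\<lambda>y. f (x, y)) has_field_derivative b) (at y)"
proof -
  have 1: "((\<lambda>y. (x, y)) has_derivative (\<lambda>v. (0, v))) (at y)"
    by (auto intro!: derivative_eq_intros)
  from has_derivative_compose[OF 1 assms] show ?thesis
    by (simp add: has_field_derivative_def)
qed

lemma holo2_on_fst_slice:
  assumes "holo2_on f U" "open S" "\<And>x. x \<in> S \<Longrightarrow> (x, y) \<in> U"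
  shows "(\<lambda>x. f (x, y)) holomorphic_on S"
  using assms has_derivative_fst_slice unfolding holo2_on_def holomorphic_on_open[OF assms(2)]
  by blast

lemma holo2_on_snd_slice:
  assumes "holo2_on f U" "open S" "\<And>y. y \<in> S \<Longrightarrow> (x, y) \<in> U"
  shows "(\<lambda>y. f (x, y)) holomorphic_on S"
  using assms has_derivative_snd_slice unfolding holo2_on_def holomorphic_on_open[OF assms(2)]
  by blast

lemma open_contains_cball_Times:
  fixes U :: "(complex \<times> complex) set"
  assumes "open U" "0 \<in> U"
  obtains r where "r > 0" "cball 0 r \<times> cball 0 r \<subseteq> U"
proof -
  obtain A B where "open A" "open B" "(0, 0) \<in> A \<times> B" "A \<times> B \<subseteq> U"
    using open_prod_elim[OF assms] unfolding zero_prod_def by metis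
  moreover from this obtain r s where "r > 0" "cball 0 r \<subseteq> A" "s > 0" "cball 0 s \<subseteq> B"
    by (metis SigmaD1 SigmaD2 open_contains_cball)
  ultimately show ?thesis by (intro that[of "min r s"]) (auto simp: subset_eq)
qed

text \<open>The rescaled map \<open>w \<mapsto> h (r * w) / (e * r)\<close> sends the unit disc into
  itself and fixes the origin, so the classical lemma applies to it.\<close>

lemma Schwarz_lemma_scaled:
  assumes hol: "h holomorphic_on ball 0 r" and h0: "h 0 = 0"
    and bound: "\<And>z. norm z < r \<Longrightarrow> norm (h z) < e * r" and e: "e > 0" and z: "norm z < r"
  shows "norm (h z) \<le> e * norm z"
proof -
  have r: "r > 0" using z norm_ge_zero[of z] by linarith
  define k where "k = (\<lambda>w. h (of_real r * w) / of_real (e * r))"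
  have in_ball: "norm (of_real r * w) < r" if "norm w < 1" for w :: complex
    using that r by (simp add: norm_mult)
  have "k holomorphic_on ball 0 1" unfolding k_def
    by (intro holomorphic_intros holomorphic_on_compose_gen[OF _ hol, unfolded o_def])
       (use in_ball e r in auto)
  moreover have "k 0 = 0" by (simp add: k_def h0)
  moreover have "norm (k w) < 1" if "norm w < 1" for w
    using bound[OF in_ball[OF that]] e r by (simp add: k_def norm_divide norm_mult)
  moreover have "norm (z / of_real r) < 1" using z r by (simp add: norm_divide)
  ultimately have "norm (k (z / of_real r)) \<le> norm (z / of_real r)" by (rule Schwarz_Lemma(1))
  then show ?thesis using e r by (simp add: k_def norm_divide norm_mult field_simps)
qed

text \<open>Holomorphy only asks for differentiability at each point, so strict differentiability in \<open>y\<close>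
  has to be proved: Schwarz' lemma is applied to \<open>f(x, \<cdot>) - f(0, \<cdot>)\<close>, which is uniformly small.\<close>

lemma holo2_strict_partial_derivative:
  assumes f: "holo2_on f U" "0 \<in> U"
    and deriv: "(f has_derivative (\<lambda>(u, v). a * u + b * v)) (at 0)" and e: "e > 0"
  obtains s where "s > 0"
    "\<And>x y. norm x < s \<Longrightarrow> norm y < s \<Longrightarrow> norm (f (x, y) - f (x, 0) - b * y) \<le> e * norm y"
proof -
  have "open U" using f by (simp add: holo2_on_def)
  then obtain r0 where r0: "r0 > 0" "cball 0 r0 \<times> cball 0 r0 \<subseteq> U"
    using f(2) open_contains_cball_Times by blast
  have "((\<lambda>y. f (0, y)) has_field_derivative b) (at 0)"
    using has_derivative_snd_slice deriv by (simp add: zero_prod_def)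
  moreover have "e / 2 > 0" using e by simp
  ultimately obtain d where d: "d > 0"
    "\<And>y. norm y < d \<Longrightarrow> norm (f (0, y) - f (0, 0) - b * y) \<le> e / 2 * norm y"
    unfolding has_field_derivative_def has_derivative_at_alt diff_zero by blast
  define r where "r = min r0 d"
  have r: "r > 0" "r \<le> d" "cball 0 r \<times> cball 0 r \<subseteq> U"
    using r0 d by (auto simp: r_def)
  have "uniformly_continuous_on (cball 0 r \<times> cball 0 r) f"
    by (intro compact_uniformly_continuous compact_Times compact_cball
        continuous_on_subset[OF holo2_on_imp_continuous_on[OF f(1)] r(3)])
  \<comment> \<open>Two errors of this size stay below \<open>e / 2 * r\<close>, the bound required
    for Schwarz' lemma. The other half of \<open>e\<close> pays for the derivative along
    \<open>x = 0\<close>.\<close>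
  moreover have "e * r / 8 > 0" using e r(1) by simp
  ultimately obtain t where t: "t > 0"
    "\<And>z z'. z \<in> cball 0 r \<times> cball 0 r \<Longrightarrow> z' \<in> cball 0 r \<times> cball 0 r \<Longrightarrow> dist z' z < t
       \<Longrightarrow> dist (f z') (f z) < e * r / 8"
    unfolding uniformly_continuous_on_def by blast
  show ?thesis
  proof (rule that[of "min r t"])
    show "min r t > 0" using r t by simp
    fix x y :: complex assume xy: "norm x < min r t" "norm y < min r t"
    define h where "h = (\<lambda>y. (f (x, y) - f (x, 0)) - (f (0, y) - f (0, 0)))"
    have close: "norm (f (x, w) - f (0, w)) < e * r / 8" if "norm w < r" for w
      using t(2)[of "(0, w)" "(x, w)"] that xy r by (auto simp: dist_Pair_Pair dist_norm)
    have "norm (h y) \<le> e / 2 * norm y"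
    proof (rule Schwarz_lemma_scaled)
      show "h holomorphic_on ball 0 r"
        unfolding h_def by (intro holomorphic_intros holo2_on_snd_slice[OF f(1)])
          (use xy r in auto)
      show "norm (h w) < e / 2 * r" if "norm w < r" for w
      proof -
        have "h w = (f (x, w) - f (0, w)) - (f (x, 0) - f (0, 0))" by (simp add: h_def)
        also have "norm \<dots> \<le> norm (f (x, w) - f (0, w)) + norm (f (x, 0) - f (0, 0))"
          by (rule norm_triangle_ineq4)
        also have "\<dots> < e * r / 8 + e * r / 8"
          using close[OF that] close[of 0] r by simp
        also have "\<dots> \<le> e / 2 * r" using e r by simp
        finally show ?thesis .
      qed
    qed (use e xy in \<open>auto simp: h_def\<close>)
    moreover have "norm (f (0, y) - f (0, 0) - b * y) \<le> e / 2 * norm y"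
      using d(2) xy r by simp
    moreover have "f (x, y) - f (x, 0) - b * y = h y + (f (0, y) - f (0, 0) - b * y)"
      by (simp add: h_def)
    ultimately show "norm (f (x, y) - f (x, 0) - b * y) \<le> e * norm y"
      using norm_triangle_ineq[of "h y" "f (0, y) - f (0, 0) - b * y"] by (simp only:)
  qed
qed

section \<open>Limits along quasi-homogeneous branches\<close>

lemma tendsto_power_0: "0 < n \<Longrightarrow> ((\<lambda>t. t ^ n) \<longlongrightarrow> 0) (at (0 :: complex))"
  by (rule tendsto_eq_intros | simp)+

lemma filterlim_power_at_0: "0 < n \<Longrightarrow> filterlim (\<lambda>t. t ^ n) (at 0) (at (0 :: complex))"
  unfolding filterlim_at using tendsto_power_0 by (auto simp: eventually_at_filter)

text \<open>Differentiability at the origin alone leaves an error \<open>o(t ^ p)\<close>, too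
  coarse at order \<open>q\<close> when \<open>p < q\<close>. The strict estimate compares the
  points \<open>(t ^ p, \<mu> * t ^ q)\<close> and \<open>(t ^ p, 0)\<close> directly, with an error
  small relative to \<open>\<mu> * t ^ q\<close>.\<close>

lemma holo2_branch_increment_tendsto:
  assumes f: "holo2_on f U" "0 \<in> U"
    and deriv: "(f has_derivative (\<lambda>(u, v). a * u + b * v)) (at 0)"
    and p: "0 < p" and q: "0 < q"
  shows "((\<lambda>t. (f (t ^ p, \<mu> * t ^ q) - f (t ^ p, 0)) / t ^ q) \<longlongrightarrow> b * \<mu>) (at 0)"
proof (rule tendstoI)
  fix e :: real assume "e > 0"
  \<comment> \<open>The summand 1 covers \<open>\<mu> = 0\<close> and makes
    \<open>e' * norm \<mu> < e\<close> strict.\<close>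
  define e' where "e' = e / (norm \<mu> + 1)"
  have "norm \<mu> + 1 > 0" using norm_ge_zero[of \<mu>] by linarith
  then have e': "e' > 0" "e' * norm \<mu> < e" using \<open>e > 0\<close> by (auto simp: e'_def field_simps)
  obtain s where s: "s > 0"
    "\<And>x y. norm x < s \<Longrightarrow> norm y < s \<Longrightarrow> norm (f (x, y) - f (x, 0) - b * y) \<le> e' * norm y"
    using holo2_strict_partial_derivative[OF f deriv e'(1)] by blast
  have "((\<lambda>t. \<mu> * t ^ q) \<longlongrightarrow> 0) (at 0)"
    by (rule tendsto_mult_right_zero tendsto_power_0 q)+
  from tendstoD[OF this s(1)] tendstoD[OF tendsto_power_0[OF p] s(1)]
  have "\<forall>\<^sub>F t in at 0. norm (\<mu> * t ^ q) < s" "\<forall>\<^sub>F t in at 0. norm ((t :: complex) ^ p) < s"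
    by simp_all
  moreover have "\<forall>\<^sub>F t in at (0 :: complex). t \<noteq> 0" by (simp add: eventually_at_filter)
  ultimately show "\<forall>\<^sub>F t in at 0. dist ((f (t ^ p, \<mu> * t ^ q) - f (t ^ p, 0)) / t ^ q) (b * \<mu>) < e"
  proof eventually_elim
    case (elim t)
    have "norm (f (t ^ p, \<mu> * t ^ q) - f (t ^ p, 0) - b * (\<mu> * t ^ q)) / norm (t ^ q) \<le> e' * norm \<mu>"
      using s(2)[OF elim(2,1)] elim(3) by (simp add: norm_mult field_simps)
    moreover have "(f (t ^ p, \<mu> * t ^ q) - f (t ^ p, 0)) / t ^ q - b * \<mu> =
        (f (t ^ p, \<mu> * t ^ q) - f (t ^ p, 0) - b * (\<mu> * t ^ q)) / t ^ q"
      using elim(3) by (simp add: field_simps)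
    ultimately show ?case using e'(2) by (simp add: dist_norm norm_divide)
  qed
qed

text \<open>The value on the axis contributes \<open>a * t ^ p\<close> to leading order. The
  increment away from the axis has order at least \<open>q > p\<close> and disappears in the
  limit.\<close>

lemma holo2_branch_tendsto:
  assumes f: "holo2_on f U" "0 \<in> U" "f 0 = 0"
    and deriv: "(f has_derivative (\<lambda>(u, v). a * u + b * v)) (at 0)"
    and p: "0 < p" and q: "p < q"
  shows "((\<lambda>t. f (t ^ p, \<mu> * t ^ q) / t ^ p) \<longlongrightarrow> a) (at 0)"
proof -
  have "((\<lambda>x. f (x, 0)) has_field_derivative a) (at 0)"
    using has_derivative_fst_slice deriv by (simp add: zero_prod_def)
  then have "((\<lambda>x. f (x, 0) / x) \<longlongrightarrow> a) (at 0)"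
    using f(3) by (simp add: DERIV_def zero_prod_def)
  from filterlim_compose[OF this filterlim_power_at_0[OF p]]
  have 1: "((\<lambda>t. f (t ^ p, 0) / t ^ p) \<longlongrightarrow> a) (at 0)" .
  have "((\<lambda>t. (f (t ^ p, \<mu> * t ^ q) - f (t ^ p, 0)) / t ^ q * t ^ (q - p) + f (t ^ p, 0) / t ^ p)
      \<longlongrightarrow> b * \<mu> * 0 + a) (at 0)"
    by (intro tendsto_intros holo2_branch_increment_tendsto[OF f(1,2) deriv] 1 tendsto_power_0)
       (use p q in auto)
  then show ?thesis
  proof (rule Lim_transform_eventually[OF tendsto_eq_rhs])
    have "\<forall>\<^sub>F t in at (0 :: complex). t \<noteq> 0" by (simp add: eventually_at_filter)
    then show "\<forall>\<^sub>F t in at 0. (f (t ^ p, \<mu> * t ^ q) - f (t ^ p, 0)) / t ^ q * t ^ (q - p)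
        + f (t ^ p, 0) / t ^ p = f (t ^ p, \<mu> * t ^ q) / t ^ p"
    proof eventually_elim
      case (elim t)
      have "t ^ q = t ^ p * t ^ (q - p)" using q by (simp flip: power_add)
      then show ?case using elim by (simp add: field_simps)
    qed
  qed simp
qed

text \<open>Disjoint neighbourhoods of two different limits would make the functions eventually
  different. Limits can therefore be compared although a given factor of the target is only known to
  vanish for arbitrarily small \<open>t\<close>.\<close>

lemma tendsto_unique_frequently_eq:
  fixes F :: "'a filter" and f g :: "'a \<Rightarrow> 'b :: t2_space"
  assumes "(f \<longlongrightarrow> x) F" "(g \<longlongrightarrow> y) F" "\<exists>\<^sub>F t in F. f t = g t"
  shows "x = y"
proof (rule ccontr)
  assume "x \<noteq> y"
  from hausdorff[OF this] obtain A B where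
    AB: "open A" "open B" "x \<in> A" "y \<in> B" "A \<inter> B = {}" by auto
  from topological_tendstoD[OF assms(1) AB(1,3)] topological_tendstoD[OF assms(2) AB(2,4)]
  have "\<forall>\<^sub>F t in F. f t \<noteq> g t" by eventually_elim (use AB(5) in auto)
  with assms(3) show False by (simp add: frequently_def)
qed

text \<open>Unless \<open>u\<close> vanishes identically, \<open>u w = h w * w ^ i\<close> with
  \<open>h 0 \<noteq> 0\<close>, so \<open>u (t ^ p)\<close> has exact order \<open>p * i\<close>. A
  bound along arbitrarily small \<open>t\<close> already forces \<open>q \<le> p * i\<close>, and
  equality would make \<open>p\<close> a divisor of \<open>q\<close>.\<close>

lemma holomorphic_frequently_bounded_order:
  assumes u: "u holomorphic_on ball 0 r" "r > 0" and p: "0 < p"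
    and bound: "\<exists>\<^sub>F t in at 0. norm (u (t ^ p)) \<le> C * norm t ^ q"
  obtains L where "((\<lambda>t. u (t ^ p) / t ^ q) \<longlongrightarrow> L) (at 0)" "\<not> p dvd q \<Longrightarrow> L = 0"
proof (cases "\<exists>w\<in>ball 0 r. u w \<noteq> 0")
  \<comment> \<open>The zero function has no order of vanishing; here \<open>L = 0\<close>.\<close>
  case False
  have "\<forall>\<^sub>F t in at 0. norm ((t :: complex) ^ p) < r"
    using tendstoD[OF tendsto_power_0[OF p] u(2)] by (simp add: dist_norm)
  then have "\<forall>\<^sub>F t in at 0. 0 = u (t ^ p) / t ^ q"
    by eventually_elim (use False in auto)
  from Lim_transform_eventually[OF tendsto_const this] show ?thesis using that by blast
next
  case True
  obtain h s i where h: "s > 0" "h holomorphic_on cball 0 s"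
    "\<And>w. w \<in> cball 0 s \<Longrightarrow> u w = h w * w ^ i \<and> h w \<noteq> 0"
  proof -
    have "0 \<in> ball (0 :: complex) r" using u(2) by simp
    from zorder_exist_zero[OF u(1) open_ball connected_ball this True]
    obtain s where "s > 0" "zor_poly u 0 holomorphic_on cball 0 s"
      "\<forall>w\<in>cball 0 s. u w = zor_poly u 0 w * (w - 0) ^ nat (zorder u 0) \<and> zor_poly u 0 w \<noteq> 0"
      by blast
    then show thesis by (intro that[of s "zor_poly u 0" "nat (zorder u 0)"]) simp_all
  qed
  have ev: "\<forall>\<^sub>F t in at 0. t \<noteq> 0 \<and> u (t ^ p) = h (t ^ p) * t ^ (p * i)"
  proof -
    have "\<forall>\<^sub>F t in at 0. norm ((t :: complex) ^ p) < s"
      using tendstoD[OF tendsto_power_0[OF p] h(1)] by (simp add: dist_norm)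
    moreover have "\<forall>\<^sub>F t in at (0 :: complex). t \<noteq> 0" by (simp add: eventually_at_filter)
    ultimately show ?thesis by eventually_elim (use h(3) in \<open>auto simp: power_mult\<close>)
  qed
  have "isCont h 0"
    by (rule continuous_on_interior[OF holomorphic_on_imp_continuous_on[OF h(2)]])
       (use h(1) in simp)
  then have "(h \<longlongrightarrow> h 0) (at 0)" by (simp add: isCont_def)
  from filterlim_compose[OF this filterlim_power_at_0[OF p]]
  have lim: "((\<lambda>t. h (t ^ p)) \<longlongrightarrow> h 0) (at 0)" .
  have "q \<le> p * i"
  proof (rule ccontr)
    assume less: "\<not> q \<le> p * i"
    have "((\<lambda>t :: complex. C * norm (t ^ (q - p * i))) \<longlongrightarrow> C * norm (0 :: complex)) (at 0)"
      by (rule tendsto_mult_left[OF tendsto_norm[OF tendsto_power_0]]) (use less in simp)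
    from tendsto_diff[OF tendsto_norm[OF lim] this]
    have "((\<lambda>t. norm (h (t ^ p)) - C * norm (t ^ (q - p * i))) \<longlongrightarrow> norm (h 0)) (at 0)" by simp
    moreover have "norm (h 0) > 0" using h(1) h(3)[of 0] by simp
    ultimately have "\<forall>\<^sub>F t in at 0. norm (h (t ^ p)) - C * norm (t ^ (q - p * i)) > 0"
      by (rule order_tendstoD)
    with ev have "\<forall>\<^sub>F t in at 0. \<not> norm (u (t ^ p)) \<le> C * norm t ^ q"
    proof eventually_elim
      case (elim t)
      have "norm t ^ q = norm t ^ (q - p * i) * norm t ^ (p * i)"
        using less by (simp flip: power_add)
      then show ?case using elim by (simp add: norm_mult norm_power)
    qed
    with bound show False by (simp add: frequently_def)
  qed
  \<comment> \<open>Since \<open>0 ^ 0 = 1\<close>, this limit is \<open>h 0\<close> when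
    \<open>p * i = q\<close> and 0 when \<open>p * i > q\<close>, which treats both cases at
    once.\<close>
  have "((\<lambda>t. h (t ^ p) * t ^ (p * i - q)) \<longlongrightarrow> h 0 * 0 ^ (p * i - q)) (at 0)"
    by (intro tendsto_intros lim)
  moreover from ev have "\<forall>\<^sub>F t in at 0. h (t ^ p) * t ^ (p * i - q) = u (t ^ p) / t ^ q"
  proof eventually_elim
    case (elim t)
    have "t ^ (p * i) = t ^ (p * i - q) * t ^ q" using \<open>q \<le> p * i\<close> by (simp flip: power_add)
    then show ?case using elim by simp
  qed
  ultimately have "((\<lambda>t. u (t ^ p) / t ^ q) \<longlongrightarrow> h 0 * 0 ^ (p * i - q)) (at 0)"
    by (rule Lim_transform_eventually)
  moreover have "h 0 * 0 ^ (p * i - q) = 0" if "\<not> p dvd q"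
  proof -
    have "p * i \<noteq> q" using that by auto
    with \<open>q \<le> p * i\<close> show ?thesis by (simp add: power_0_left)
  qed
  ultimately show ?thesis using that by blast
qed

section \<open>Images of quasi-homogeneous branches under a biholomorphism\<close>

text \<open>A biholomorphism enters only through its two components and its invertible matrix at the
  origin. In this form the two target coordinates play symmetric roles.\<close>

locale biholo_germ =
  fixes f g :: "complex \<times> complex \<Rightarrow> complex" and U a b c d
  assumes holo: "holo2_on f U" "holo2_on g U" and zero_in: "0 \<in> U"
    and zero: "f 0 = 0" "g 0 = 0"
    and deriv: "(f has_derivative (\<lambda>(u, v). a * u + b * v)) (at 0)"
      "(g has_derivative (\<lambda>(u, v). c * u + d * v)) (at 0)"
    and det: "a * d - b * c \<noteq> 0"
begin

text \<open>Turns statements about branches sent to the axis \<open>y = 0\<close> into statements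
  about branches sent to \<open>x = 0\<close>.\<close>

lemma swap: "biholo_germ g f U c d a b"
  by unfold_locales (use holo zero_in zero deriv det in \<open>auto simp: algebra_simps\<close>)

text \<open>The number \<open>L\<close> is the limit of an expression free of \<open>\<mu>\<close>
  and \<open>l\<close>. Hence all branches of the source share it, and for \<open>p = 1\<close> the
  induced map on slopes is affine.\<close>

lemma branch_image:
  assumes p: "0 < p" and q: "p < q"
    and freq: "\<exists>\<^sub>F t in at 0. g (t ^ p, \<mu> * t ^ q) ^ p = l * f (t ^ p, \<mu> * t ^ q) ^ q"
  obtains L where "c = 0" "((\<lambda>t. g (t ^ p, 0) / t ^ q) \<longlongrightarrow> L) (at 0)" "\<not> p dvd q \<Longrightarrow> L = 0"
    "(L + d * \<mu>) ^ p = l * a ^ q"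
proof -
  have nz: "\<forall>\<^sub>F t in at (0 :: complex). t \<noteq> 0" by (simp add: eventually_at_filter)
  define G where "G = (\<lambda>t. g (t ^ p, \<mu> * t ^ q))"
  define H where "H = (\<lambda>t. f (t ^ p, \<mu> * t ^ q))"
  have H: "((\<lambda>t. H t / t ^ p) \<longlongrightarrow> a) (at 0)"
    unfolding H_def by (rule holo2_branch_tendsto[OF holo(1) zero_in zero(1) deriv(1) p q])
  have G: "((\<lambda>t. G t / t ^ p) \<longlongrightarrow> c) (at 0)"
    unfolding G_def by (rule holo2_branch_tendsto[OF holo(2) zero_in zero(2) deriv(2) p q])
  have incr: "((\<lambda>t. (G t - g (t ^ p, 0)) / t ^ q) \<longlongrightarrow> d * \<mu>) (at 0)"
    unfolding G_def using holo2_branch_increment_tendsto[OF holo(2) zero_in deriv(2) p] q by simp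
  have eqn: "\<exists>\<^sub>F t in at 0. t \<noteq> 0 \<and> G t ^ p = l * H t ^ q"
    using frequently_eventually_conj[OF freq nz] by (simp add: G_def H_def)
  have qp: "q * p = (q - p) * p + p * p" using q by (simp flip: add_mult_distrib)
  \<comment> \<open>Division of the equation by \<open>t ^ (p * p)\<close> leaves the factor
    \<open>t ^ ((q - p) * p)\<close> on the right, which tends to 0.\<close>
  have "c ^ p = l * a ^ q * 0"
  proof (rule tendsto_unique_frequently_eq)
    show "((\<lambda>t. (G t / t ^ p) ^ p) \<longlongrightarrow> c ^ p) (at 0)" by (intro tendsto_intros G)
    show "((\<lambda>t. l * (H t / t ^ p) ^ q * t ^ ((q - p) * p)) \<longlongrightarrow> l * a ^ q * 0) (at 0)"
      by (intro tendsto_intros H tendsto_power_0) (use p q in auto)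
    show "\<exists>\<^sub>F t in at 0. (G t / t ^ p) ^ p = l * (H t / t ^ p) ^ q * t ^ ((q - p) * p)"
      using eqn
    proof (rule frequently_elim1)
      fix t assume t: "t \<noteq> 0 \<and> G t ^ p = l * H t ^ q"
      have "t ^ (p * q) = t ^ ((q - p) * p) * t ^ (p * p)"
        using qp by (simp add: ac_simps flip: power_add)
      with t show "(G t / t ^ p) ^ p = l * (H t / t ^ p) ^ q * t ^ ((q - p) * p)"
        by (simp add: power_divide flip: power_mult)
    qed
  qed
  then have c0: "c = 0" using p by simp
  \<comment> \<open>Division by \<open>t ^ (p * q)\<close> balances both sides; the right one
    converges, so \<open>G t / t ^ q\<close> is bounded for arbitrarily small
    \<open>t\<close>.\<close>
  have eqn': "\<exists>\<^sub>F t in at 0. (G t / t ^ q) ^ p = l * (H t / t ^ p) ^ q"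
    using eqn
  proof (rule frequently_elim1)
    fix t assume t: "t \<noteq> 0 \<and> G t ^ p = l * H t ^ q"
    then show "(G t / t ^ q) ^ p = l * (H t / t ^ p) ^ q"
      by (simp add: power_divide mult.commute flip: power_mult)
  qed
  have limr: "((\<lambda>t. l * (H t / t ^ p) ^ q) \<longlongrightarrow> l * a ^ q) (at 0)" by (intro tendsto_intros H)
  have Cbound: "\<forall>\<^sub>F t in at 0. norm (l * (H t / t ^ p) ^ q) < norm (l * a ^ q) + 1"
    using order_tendstoD(2)[OF tendsto_norm[OF limr]] by simp
  have incrbound: "\<forall>\<^sub>F t in at 0. norm ((G t - g (t ^ p, 0)) / t ^ q) < norm (d * \<mu>) + 1"
    using order_tendstoD(2)[OF tendsto_norm[OF incr]] by simp
  \<comment> \<open>Either \<open>G t / t ^ q\<close> has norm at most 1 or its norm is at most the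
    \<open>p\<close>-th power of itself; this gives the first two summands. The last bounds the
    increment quotient, which has to be subtracted to reach \<open>g (t ^ p, 0)\<close>.\<close>
  define K where "K = (norm (l * a ^ q) + 1) + 1 + (norm (d * \<mu>) + 1)"
  have "\<exists>\<^sub>F t in at 0. norm (g (t ^ p, 0)) \<le> K * norm t ^ q"
    using frequently_eventually_conj[OF eqn' eventually_conj[OF nz eventually_conj[OF Cbound incrbound]]]
  proof (rule frequently_elim1)
    fix t assume t: "(t \<noteq> 0 \<and> norm (l * (H t / t ^ p) ^ q) < norm (l * a ^ q) + 1 \<and>
        norm ((G t - g (t ^ p, 0)) / t ^ q) < norm (d * \<mu>) + 1) \<and>
        (G t / t ^ q) ^ p = l * (H t / t ^ p) ^ q"
    have "norm (G t / t ^ q) \<le> norm (l * a ^ q) + 1 + 1"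
    proof (cases "norm (G t / t ^ q) \<le> 1")
      case False
      then have "norm (G t / t ^ q) ^ 1 \<le> norm (G t / t ^ q) ^ p"
        using p by (intro power_increasing) auto
      also have "\<dots> = norm (l * (H t / t ^ p) ^ q)" using t by (simp flip: norm_power)
      finally show ?thesis using t by simp
    qed (use norm_ge_zero[of "l * a ^ q"] in linarith)
    moreover have "g (t ^ p, 0) / t ^ q = G t / t ^ q - (G t - g (t ^ p, 0)) / t ^ q"
      by (simp add: diff_divide_distrib)
    ultimately have "norm (g (t ^ p, 0) / t ^ q) \<le> K"
      using t norm_triangle_ineq4[of "G t / t ^ q" "(G t - g (t ^ p, 0)) / t ^ q"]
      by (simp add: K_def)
    then show "norm (g (t ^ p, 0)) \<le> K * norm t ^ q"
      using t by (simp add: norm_divide norm_power field_simps)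
  qed
  moreover obtain r where r: "r > 0" "cball 0 r \<times> cball 0 r \<subseteq> U"
    using open_contains_cball_Times[of U] holo(1) zero_in by (auto simp: holo2_on_def)
  moreover have "(\<lambda>x. g (x, 0)) holomorphic_on ball 0 r"
    by (rule holo2_on_fst_slice[OF holo(2)]) (use r in auto)
  ultimately obtain L where L: "((\<lambda>t. g (t ^ p, 0) / t ^ q) \<longlongrightarrow> L) (at 0)" "\<not> p dvd q \<Longrightarrow> L = 0"
    using holomorphic_frequently_bounded_order[OF _ _ p] by blast
  have "(\<lambda>t. G t / t ^ q) = (\<lambda>t. g (t ^ p, 0) / t ^ q + (G t - g (t ^ p, 0)) / t ^ q)"
    by (simp add: diff_divide_distrib)
  then have "((\<lambda>t. G t / t ^ q) \<longlongrightarrow> L + d * \<mu>) (at 0)" using tendsto_add[OF L(1) incr] by simp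
  then have "((\<lambda>t. (G t / t ^ q) ^ p) \<longlongrightarrow> (L + d * \<mu>) ^ p) (at 0)" by (rule tendsto_power)
  from tendsto_unique_frequently_eq[OF this limr eqn'] show ?thesis using that c0 L by blast
qed

lemma branch_image_axis:
  assumes p: "0 < p" and q: "p < q"
    and freq: "\<exists>\<^sub>F t in at 0. g (t ^ p, \<mu> * t ^ q) = 0"
  obtains L where "c = 0" "((\<lambda>t. g (t ^ p, 0) / t ^ q) \<longlongrightarrow> L) (at 0)" "\<not> p dvd q \<Longrightarrow> L = 0"
    "L + d * \<mu> = 0"
proof -
  have "\<exists>\<^sub>F t in at 0. g (t ^ p, \<mu> * t ^ q) ^ p = 0 * f (t ^ p, \<mu> * t ^ q) ^ q"
    using freq p by simp
  from branch_image[OF p q this] show ?thesis using that p by auto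
qed

text \<open>On the line \<open>x = 0\<close> both components have order at least 1 in
  \<open>t\<close>, so \<open>g ^ p = l * f ^ q\<close> with \<open>p < q\<close> leaves no room for
  a linear term of \<open>g\<close>. Together with \<open>c = 0\<close> this contradicts
  invertibility, so the axis \<open>x = 0\<close> can only be sent to itself.\<close>

lemma vertical_axis_image:
  assumes p: "0 < p" and q: "p < q"
    and freq: "\<exists>\<^sub>F t in at 0. g (0, t) ^ p = l * f (0, t) ^ q"
  shows "d = 0"
proof -
  have "((\<lambda>y. f (0, y)) has_field_derivative b) (at 0)" "((\<lambda>y. g (0, y)) has_field_derivative d) (at 0)"
    using has_derivative_snd_slice deriv by (auto simp: zero_prod_def)
  then have lim: "((\<lambda>y. f (0, y) / y) \<longlongrightarrow> b) (at 0)" "((\<lambda>y. g (0, y) / y) \<longlongrightarrow> d) (at 0)"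
    using zero by (auto simp: DERIV_def zero_prod_def)
  have "d ^ p = l * b ^ q * 0"
  proof (rule tendsto_unique_frequently_eq)
    show "((\<lambda>t. (g (0, t) / t) ^ p) \<longlongrightarrow> d ^ p) (at 0)" by (intro tendsto_intros lim)
    show "((\<lambda>t. l * (f (0, t) / t) ^ q * t ^ (q - p)) \<longlongrightarrow> l * b ^ q * 0) (at 0)"
      by (intro tendsto_intros lim tendsto_power_0) (use q in auto)
    have "\<forall>\<^sub>F t in at (0 :: complex). t \<noteq> 0" by (simp add: eventually_at_filter)
    from frequently_eventually_conj[OF freq this]
    show "\<exists>\<^sub>F t in at 0. (g (0, t) / t) ^ p = l * (f (0, t) / t) ^ q * t ^ (q - p)"
    proof (rule frequently_elim1)
      fix t assume t: "t \<noteq> 0 \<and> g (0, t) ^ p = l * f (0, t) ^ q"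
      have "t ^ q = t ^ (q - p) * t ^ p" using q by (simp flip: power_add)
      with t show "(g (0, t) / t) ^ p = l * (f (0, t) / t) ^ q * t ^ (q - p)"
        by (simp add: power_divide)
    qed
  qed
  then show ?thesis using p by simp
qed

end

section \<open>From equivalent germs to components, and the zero sets of the normal forms\<close>

lemma germ_biholo_germ0E:
  assumes "germ_biholo (germ0 A) (germ0 B)"
  obtains f g U a b c d where "biholo_germ f g U a b c d"
    "\<forall>\<^sub>F z in nhds 0. z \<in> A \<longrightarrow> (f z, g z) \<in> B"
proof -
  obtain \<Phi> U V A' where *: "local_biholo \<Phi> U V" "germ0 A = germ0 A'"
    "germ0 B = germ0 (\<Phi> ` (A' \<inter> U))"
    using assms unfolding germ_biholo_def by blast
  define \<Psi> where "\<Psi> = inv_into U \<Phi>"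
  define f g where "f = (\<lambda>z. fst (\<Phi> z))" and "g = (\<lambda>z. snd (\<Phi> z))"
  have lb: "open U" "0 \<in> U" "0 \<in> V" "\<Phi> 0 = 0" "bij_betw \<Phi> U V"
    "holo2_on f U" "holo2_on g U" "holo2_map_on \<Psi> V"
    using *(1) by (auto simp: local_biholo_def \<Psi>_def holo2_map_on_def f_def g_def)
  obtain a b c d where deriv: "(f has_derivative (\<lambda>(u, v). a * u + b * v)) (at 0)"
    "(g has_derivative (\<lambda>(u, v). c * u + d * v)) (at 0)"
    using lb unfolding holo2_on_def by meson
  obtain s t s' t' where deriv': "((\<lambda>z. fst (\<Psi> z)) has_derivative (\<lambda>(u, v). s * u + t * v)) (at 0)"
    "((\<lambda>z. snd (\<Psi> z)) has_derivative (\<lambda>(u, v). s' * u + t' * v)) (at 0)"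
    using lb unfolding holo2_map_on_def holo2_on_def by meson
  have "(\<Phi> has_derivative (\<lambda>w. ((\<lambda>(u, v). a * u + b * v) w, (\<lambda>(u, v). c * u + d * v) w))) (at 0)"
    using has_derivative_Pair[OF deriv] by (simp add: f_def g_def)
  then have \<Phi>: "(\<Phi> has_derivative (\<lambda>(u, v). (a * u + b * v, c * u + d * v))) (at 0)"
    by (simp add: split_def)
  have inv: "\<Psi> (\<Phi> z) = z" if "z \<in> U" for z
    using lb(5) that by (simp add: \<Psi>_def bij_betw_inv_into_left)
  have "((\<lambda>z. fst (\<Psi> (\<Phi> z))) has_derivative (\<lambda>(u, v). s * (a * u + b * v) + t * (c * u + d * v))) (at 0)"
    using has_derivative_compose[OF \<Phi>, of "\<lambda>z. fst (\<Psi> z)" "\<lambda>(u, v). s * u + t * v"] deriv'(1) lb(4) by (simp add: split_def)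
  then have "(fst has_derivative (\<lambda>(u, v). s * (a * u + b * v) + t * (c * u + d * v))) (at 0)"
    by (rule has_derivative_transform_within_open[OF _ lb(1,2)]) (simp add: inv)
  from has_derivative_unique[OF this bounded_linear_imp_has_derivative[OF bounded_linear_fst]]
  have e1: "s * (a * u + b * v) + t * (c * u + d * v) = u" for u v by (auto dest: fun_cong[of _ _ "(u, v)"])
  have "((\<lambda>z. snd (\<Psi> (\<Phi> z))) has_derivative (\<lambda>(u, v). s' * (a * u + b * v) + t' * (c * u + d * v))) (at 0)"
    using has_derivative_compose[OF \<Phi>, of "\<lambda>z. snd (\<Psi> z)" "\<lambda>(u, v). s' * u + t' * v"] deriv'(2) lb(4) by (simp add: split_def)
  then have "(snd has_derivative (\<lambda>(u, v). s' * (a * u + b * v) + t' * (c * u + d * v))) (at 0)"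
    by (rule has_derivative_transform_within_open[OF _ lb(1,2)]) (simp add: inv)
  from has_derivative_unique[OF this bounded_linear_imp_has_derivative[OF bounded_linear_snd]]
  have e2: "s' * (a * u + b * v) + t' * (c * u + d * v) = v" for u v by (auto dest: fun_cong[of _ _ "(u, v)"])
  \<comment> \<open>Multiplicativity of determinants: the matrices of the map and of its inverse at
    the origin multiply to the identity.\<close>
  have "(s * t' - t * s') * (a * d - b * c) =
      (s * a + t * c) * (s' * b + t' * d) - (s * b + t * d) * (s' * a + t' * c)" by algebra
  also have "\<dots> = 1" using e1[of 1 0] e1[of 0 1] e2[of 1 0] e2[of 0 1] by simp
  finally have "a * d - b * c \<noteq> 0" by auto
  then have "biholo_germ f g U a b c d"
    using lb deriv by unfold_locales (auto simp: f_def g_def)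
  \<comment> \<open>One inclusion is enough: equality of slope sets will come from cardinality, and
    equality of exponents from the inverse germ.\<close>
  moreover have "\<forall>\<^sub>F z in nhds 0. z \<in> A \<longrightarrow> (f z, g z) \<in> B"
  proof -
    have "\<forall>\<^sub>F z in nhds 0. z \<in> B \<longleftrightarrow> z \<in> \<Phi> ` (A' \<inter> U)" using *(3) by (simp add: germ0_eq_iff)
    from eventually_local_biholo[OF *(1) this]
    have "\<forall>\<^sub>F z in nhds 0. z \<in> U \<and> (\<Phi> z \<in> B \<longleftrightarrow> \<Phi> z \<in> \<Phi> ` (A' \<inter> U))" .
    moreover have "\<forall>\<^sub>F z in nhds 0. z \<in> A \<longleftrightarrow> z \<in> A'" using *(2) by (simp add: germ0_eq_iff)
    ultimately show ?thesis by eventually_elim (auto simp: f_def g_def)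
  qed
  ultimately show ?thesis using that by blast
qed

text \<open>A common form for both families: type \<open>(1, q)\<close> is the case
  \<open>p = 1\<close>, \<open>k = 0\<close>, so the branch arguments are shared.\<close>

definition qh_zeros :: "nat \<Rightarrow> nat \<Rightarrow> nat \<Rightarrow> nat \<Rightarrow> complex list \<Rightarrow> (complex \<times> complex) set" where
  "qh_zeros p q m k ls = {(x, y). x ^ m * y ^ k * (\<Prod>l\<leftarrow>ls. y ^ p - l * x ^ q) = 0}"

lemma qh_zeros_iff:
  "(x, y) \<in> qh_zeros p q m k ls \<longleftrightarrow>
     m \<noteq> 0 \<and> x = 0 \<or> k \<noteq> 0 \<and> y = 0 \<or> (\<exists>l\<in>set ls. y ^ p = l * x ^ q)"
  by (auto simp: qh_zeros_def prod_list_zero_iff)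

lemma C_pq_eq: "C_pq p q m k ls = germ0 (qh_zeros p q m k ls)"
  by (simp add: C_pq_def qh_zeros_def)

lemma C_1q_eq: "C_1q q m ls = germ0 (qh_zeros 1 q m 0 ls)"
  by (simp add: C_1q_def qh_zeros_def)

text \<open>Asking for infinitely many zeros near the origin suffices for passing to limits and avoids the
  irreducibility of branches.\<close>

lemma qh_zeros_frequently_component:
  assumes ev: "\<forall>\<^sub>F z in nhds 0. z \<in> A \<longrightarrow> (f z, g z) \<in> qh_zeros p q m k ls"
    and path: "(\<gamma> \<longlongrightarrow> 0) (at (0 :: complex))" "\<And>t. \<gamma> t \<in> A"
  shows "m \<noteq> 0 \<and> (\<exists>\<^sub>F t in at 0. f (\<gamma> t) = 0) \<or> k \<noteq> 0 \<and> (\<exists>\<^sub>F t in at 0. g (\<gamma> t) = 0) \<or>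
    (\<exists>l\<in>set ls. \<exists>\<^sub>F t in at 0. g (\<gamma> t) ^ p = l * f (\<gamma> t) ^ q)"
proof -
  have "\<forall>\<^sub>F t in at 0. \<gamma> t \<in> A \<longrightarrow> (f (\<gamma> t), g (\<gamma> t)) \<in> qh_zeros p q m k ls"
    using path(1) ev unfolding filterlim_iff by blast
  then have "\<forall>\<^sub>F t in at 0. m \<noteq> 0 \<and> f (\<gamma> t) = 0 \<or> k \<noteq> 0 \<and> g (\<gamma> t) = 0 \<or>
      (\<exists>l\<in>set ls. g (\<gamma> t) ^ p = l * f (\<gamma> t) ^ q)"
    by (simp add: path(2) qh_zeros_iff)
  then have "\<exists>\<^sub>F t in at 0. m \<noteq> 0 \<and> f (\<gamma> t) = 0 \<or> k \<noteq> 0 \<and> g (\<gamma> t) = 0 \<or>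
      (\<exists>l\<in>set ls. g (\<gamma> t) ^ p = l * f (\<gamma> t) ^ q)"
    by (rule eventually_frequently[rotated]) simp
  \<comment> \<open>Unlike \<open>eventually\<close>, \<open>frequently\<close> distributes over a
    finite disjunction, so a single factor can be singled out.\<close>
  then show ?thesis
    by (auto simp: frequently_disj_iff frequently_bex_finite_distrib frequently_const)
qed

lemma branch_path_tendsto:
  assumes "0 < p" "0 < q"
  shows "((\<lambda>t. (t ^ p, \<mu> * t ^ q)) \<longlongrightarrow> 0) (at (0 :: complex))"
proof -
  have "((\<lambda>t. (t ^ p, \<mu> * t ^ q)) \<longlongrightarrow> (0, \<mu> * 0)) (at (0 :: complex))"
    by (intro tendsto_intros tendsto_power_0 assms)
  then show ?thesis by (simp add: zero_prod_def)
qed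

lemma vertical_path_tendsto: "((\<lambda>t. (0, t)) \<longlongrightarrow> 0) (at (0 :: complex))"
  unfolding zero_prod_def by (intro tendsto_intros)

lemma branch_in_qh_zeros:
  assumes "l \<in> set ls" "\<mu> ^ p = l"
  shows "(t ^ p, \<mu> * t ^ q) \<in> qh_zeros p q m k ls"
  using assms by (auto simp: qh_zeros_iff power_mult_distrib mult.commute
    intro!: bexI[of _ l] simp flip: power_mult)

lemma exists_complex_root:
  assumes "0 < n" obtains w :: complex where "w ^ n = z"
proof (cases "z = 0")
  case True
  then show ?thesis using that[of 0] assms by simp
next
  case False
  have "exp (Ln z / of_nat n) ^ n = exp (of_nat n * (Ln z / of_nat n))"
    by (rule exp_of_nat_mult[symmetric])
  then show ?thesis using that[of "exp (Ln z / of_nat n)"] False assms by simp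
qed

text \<open>Both configurations have \<open>n\<close> points, so an injective image contained in the
  target exhausts it.\<close>

lemma conf_image_eq:
  assumes "xs \<in> conf M n" "ys \<in> conf M n" "inj_on h (set xs)" "h ` set xs \<subseteq> set ys"
  shows "set ys = h ` set xs"
proof (rule sym, rule card_subset_eq)
  show "card (h ` set xs) = card (set ys)"
    using assms by (simp add: card_image conf_def distinct_card)
qed (use assms in auto)

section \<open>Exponents and slopes under a biholomorphism between normal forms\<close>

context biholo_germ
begin

text \<open>Coprimality and \<open>p \<ge> 2\<close> exclude \<open>p dvd q\<close>, so
  \<open>L = 0\<close> for every branch and no translation of slopes occurs. Branches go to branches
  and axes to axes.\<close>

lemma qh_zeros_image_pq:
  assumes pq: "2 \<le> p" "p < q" "coprime p q" and n: "1 \<le> n"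
    and ls: "ls \<in> conf (- {0}) n" and ls': "ls' \<in> conf (- {0}) n"
    and ev: "\<forall>\<^sub>F z in nhds 0. z \<in> qh_zeros p q m k ls \<longrightarrow> (f z, g z) \<in> qh_zeros p q m' k' ls'"
  shows "m \<noteq> 0 \<longrightarrow> m' \<noteq> 0" "k \<noteq> 0 \<longrightarrow> k' \<noteq> 0" "\<exists>h\<in>GL1. set ls' = h ` set ls"
proof -
  interpret swap: biholo_germ g f U c d a b by (rule swap)
  have p: "0 < p" and q: "0 < q" using pq by auto
  have ndvd: "\<not> p dvd q"
  proof
    assume "p dvd q"
    then have "gcd p q = p" by (simp add: gcd_nat.absorb1)
    then show False using pq by simp
  qed
  \<comment> \<open>Otherwise \<open>a = 0\<close> and \<open>b * \<mu> = 0\<close>, so the first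
    row of the matrix would vanish; \<open>not_y\<close> is the same for the second row.\<close>
  have not_x: "\<not> (\<exists>\<^sub>F t in at 0. f (t ^ p, \<mu> * t ^ q) = 0)" if "\<mu> \<noteq> 0" for \<mu>
  proof
    assume *: "\<exists>\<^sub>F t in at 0. f (t ^ p, \<mu> * t ^ q) = 0"
    show False by (rule swap.branch_image_axis[OF p pq(2) *]) (use ndvd that det in auto)
  qed
  have not_y: "\<not> (\<exists>\<^sub>F t in at 0. g (t ^ p, \<mu> * t ^ q) = 0)" if "\<mu> \<noteq> 0" for \<mu>
  proof
    assume *: "\<exists>\<^sub>F t in at 0. g (t ^ p, \<mu> * t ^ q) = 0"
    show False by (rule branch_image_axis[OF p pq(2) *]) (use ndvd that det in auto)
  qed
  have branch: "c = 0 \<and> (\<exists>l'\<in>set ls'. d ^ p * l = l' * a ^ q)" if l: "l \<in> set ls" for l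
  proof -
    obtain \<mu> where \<mu>: "\<mu> ^ p = l" using exists_complex_root[OF p] by blast
    have "\<mu> \<noteq> 0" using \<mu> l ls p by (auto simp: conf_def zero_power)
    with not_x[of \<mu>] not_y[of \<mu>]
      qh_zeros_frequently_component[OF ev branch_path_tendsto[OF p q] branch_in_qh_zeros[OF l \<mu>]]
    obtain l' where l': "l' \<in> set ls'"
      "\<exists>\<^sub>F t in at 0. g (t ^ p, \<mu> * t ^ q) ^ p = l' * f (t ^ p, \<mu> * t ^ q) ^ q" by auto
    show ?thesis
      by (rule branch_image[OF p pq(2) l'(2)])
         (use ndvd \<mu> l'(1) in \<open>auto simp: power_mult_distrib\<close>)
  qed
  \<comment> \<open>One branch exists because \<open>n \<ge> 1\<close>. It forces
    \<open>c = 0\<close>, and the matrix becomes triangular.\<close>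
  obtain l0 where "l0 \<in> set ls" using ls n by (cases ls) (auto simp: conf_def)
  then have "c = 0" using branch by simp
  then have ad: "a \<noteq> 0" "d \<noteq> 0" using det by auto
  show "m \<noteq> 0 \<longrightarrow> m' \<noteq> 0"
  proof (intro impI notI)
    assume m: "m \<noteq> 0" "m' = 0"
    then have "(0, t) \<in> qh_zeros p q m k ls" for t by (simp add: qh_zeros_iff)
    from qh_zeros_frequently_component[OF ev vertical_path_tendsto this] m(2)
    consider "\<exists>\<^sub>F t in at 0. g (0, t) = 0" | l where "\<exists>\<^sub>F t in at 0. g (0, t) ^ p = l * f (0, t) ^ q"
      by auto
    then have "d = 0"
    proof cases
      case 1
      then have "\<exists>\<^sub>F t in at 0. g (0, t) ^ p = 0 * f (0, t) ^ q" using p by simp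
      then show ?thesis by (rule vertical_axis_image[OF p pq(2)])
    next
      case 2
      then show ?thesis by (rule vertical_axis_image[OF p pq(2)])
    qed
    with ad show False by simp
  qed
  show "k \<noteq> 0 \<longrightarrow> k' \<noteq> 0"
  proof (intro impI notI)
    assume k: "k \<noteq> 0" "k' = 0"
    \<comment> \<open>The axis \<open>y = 0\<close> is parametrised as the branch with
      \<open>\<mu> = 0\<close>. As \<open>L = 0\<close>, landing on a branch of slope
      \<open>l\<close> would give \<open>l * a ^ q = 0\<close>, although slopes are nonzero.\<close>
    then have "(t ^ p, 0 * t ^ q) \<in> qh_zeros p q m k ls" for t by (simp add: qh_zeros_iff)
    from qh_zeros_frequently_component[OF ev branch_path_tendsto[OF p q] this] k(2)
    consider "\<exists>\<^sub>F t in at 0. f (t ^ p, 0 * t ^ q) = 0"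
      | l where "l \<in> set ls'" "\<exists>\<^sub>F t in at 0. g (t ^ p, 0 * t ^ q) ^ p = l * f (t ^ p, 0 * t ^ q) ^ q"
      by (auto simp del: mult_zero_left)
    then show False
    proof cases
      case 1
      show False by (rule swap.branch_image_axis[OF p pq(2) 1]) (use ad in simp)
    next
      case 2
      have "l * a ^ q = 0" by (rule branch_image[OF p pq(2) 2(2)]) (use ndvd p in \<open>auto simp: zero_power\<close>)
      with 2(1) ls' ad show False by (auto simp: conf_def)
    qed
  qed
  show "\<exists>h\<in>GL1. set ls' = h ` set ls"
  proof
    define \<alpha> where "\<alpha> = d ^ p / a ^ q"
    have \<alpha>: "\<alpha> \<noteq> 0" using ad by (simp add: \<alpha>_def)
    show "(\<lambda>z. \<alpha> * z) \<in> GL1" using \<alpha> by (auto simp: GL1_def)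
    show "set ls' = (\<lambda>z. \<alpha> * z) ` set ls"
    proof (rule conf_image_eq[OF ls ls'])
      show "(\<lambda>z. \<alpha> * z) ` set ls \<subseteq> set ls'"
      proof (rule image_subsetI)
        fix l assume "l \<in> set ls"
        with branch obtain l' where "l' \<in> set ls'" "d ^ p * l = l' * a ^ q" by blast
        moreover from this have "\<alpha> * l = l'" using ad by (simp add: \<alpha>_def field_simps)
        ultimately show "\<alpha> * l \<in> set ls'" by simp
      qed
    qed (use \<alpha> in \<open>auto simp: inj_on_def\<close>)
  qed
qed

text \<open>Now \<open>p = 1\<close> divides \<open>q\<close>, so \<open>L\<close> may be nonzero
  and supplies the translation. All branches and the axis \<open>x = 0\<close> are smooth, so a
  branch being sent to that axis has to be ruled out or bypassed.\<close>

lemma qh_zeros_image_1q: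
  assumes q: "1 < q" and n: "1 \<le> n"
    and ls: "ls \<in> conf UNIV n" and ls': "ls' \<in> conf UNIV n"
    and ev: "\<forall>\<^sub>F z in nhds 0. z \<in> qh_zeros 1 q m 0 ls \<longrightarrow> (f z, g z) \<in> qh_zeros 1 q m' 0 ls'"
  shows "m \<noteq> 0 \<longrightarrow> m' \<noteq> 0" "\<exists>h\<in>Aff. set ls' = h ` set ls"
proof -
  interpret swap: biholo_germ g f U c d a b by (rule swap)
  have q0: "0 < q" using q by simp
  have component: "m' \<noteq> 0 \<and> (\<exists>\<^sub>F t in at 0. f (t ^ 1, l * t ^ q) = 0) \<or>
      (\<exists>l'\<in>set ls'. \<exists>\<^sub>F t in at 0. g (t ^ 1, l * t ^ q) ^ 1 = l' * f (t ^ 1, l * t ^ q) ^ q)"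
    if "l \<in> set ls" for l
    using qh_zeros_frequently_component[OF ev branch_path_tendsto[OF zero_less_one q0]
      branch_in_qh_zeros[OF that power_one_right]] by simp
  have to_axis: "a = 0 \<and> (\<exists>L. ((\<lambda>t. f (t ^ 1, 0) / t ^ q) \<longlongrightarrow> L) (at 0) \<and> L + b * l = 0)"
    if "\<exists>\<^sub>F t in at 0. f (t ^ 1, l * t ^ q) = 0" for l
    by (rule swap.branch_image_axis[OF zero_less_one q that]) auto
  have to_branch: "c = 0 \<and> (\<exists>L. ((\<lambda>t. g (t ^ 1, 0) / t ^ q) \<longlongrightarrow> L) (at 0) \<and> L + d * l = l' * a ^ q)"
    if "\<exists>\<^sub>F t in at 0. g (t ^ 1, l * t ^ q) ^ 1 = l' * f (t ^ 1, l * t ^ q) ^ q" for l l'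
    by (rule branch_image[OF zero_less_one q that]) auto
  obtain l0 where l0: "l0 \<in> set ls" using ls n by (cases ls) (auto simp: conf_def)
  show "m \<noteq> 0 \<longrightarrow> m' \<noteq> 0"
  proof (intro impI notI)
    assume m: "m \<noteq> 0" "m' = 0"
    \<comment> \<open>With \<open>m' = 0\<close> the target has no factor \<open>x\<close>, so the
      branch \<open>l0\<close> is sent to a branch.\<close>
    then have "c = 0" using component[OF l0] to_branch[of l0] by auto
    have "(0, t) \<in> qh_zeros 1 q m 0 ls" for t using m by (simp add: qh_zeros_iff)
    from qh_zeros_frequently_component[OF ev vertical_path_tendsto this] m(2)
    obtain l where "\<exists>\<^sub>F t in at 0. g (0, t) ^ 1 = l * f (0, t) ^ q" by auto
    then have "d = 0" by (rule vertical_axis_image[OF zero_less_one q])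
    with det \<open>c = 0\<close> show False by simp
  qed
  show "\<exists>h\<in>Aff. set ls' = h ` set ls"
  \<comment> \<open>For \<open>n = 1\<close> and \<open>m = m' = 1\<close> a biholomorphism may
    exchange the branch with the axis \<open>x = 0\<close>, but any two single slopes differ by a
    translation.\<close>
  proof (cases "n = 1")
    case True
    then obtain l l' where "ls = [l]" "ls' = [l']"
      using ls ls' by (auto simp: conf_def length_Suc_conv)
    moreover have "(\<lambda>z. 1 * z + (l' - l)) \<in> Aff"
      unfolding Aff_def by (intro CollectI exI[of _ 1] exI[of _ "l' - l"]) simp
    ultimately show ?thesis by (intro bexI[of _ "\<lambda>z. 1 * z + (l' - l)"]) auto
  next
    case False
    \<comment> \<open>A second branch gives the contradiction. If it also goes to
      \<open>x = 0\<close>, the common limit \<open>L\<close> yields \<open>b = 0\<close> besides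
      \<open>a = 0\<close>; if it goes to a branch, then \<open>c = 0\<close> besides
      \<open>a = 0\<close>.\<close>
    have not_axis: "\<not> (\<exists>\<^sub>F t in at 0. f (t ^ 1, l * t ^ q) = 0)" if l: "l \<in> set ls" for l
    proof
      assume "\<exists>\<^sub>F t in at 0. f (t ^ 1, l * t ^ q) = 0"
      from to_axis[OF this] obtain L where
        L: "a = 0" "((\<lambda>t. f (t ^ 1, 0) / t ^ q) \<longlongrightarrow> L) (at 0)" "L + b * l = 0" by blast
      have "card (set ls) = n" using ls by (simp add: conf_def distinct_card)
      then have "\<not> set ls \<subseteq> {l}" using False n card_mono[of "{l}" "set ls"] by auto
      then obtain l1 where l1: "l1 \<in> set ls" "l1 \<noteq> l" by blast
      from component[OF l1(1)] show False
      proof (elim disjE conjE bexE)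
        assume "\<exists>\<^sub>F t in at 0. f (t ^ 1, l1 * t ^ q) = 0"
        from to_axis[OF this] obtain L' where
          "((\<lambda>t. f (t ^ 1, 0) / t ^ q) \<longlongrightarrow> L') (at 0)" "L' + b * l1 = 0" by blast
        moreover from this have "L' = L" using L(2) by (auto intro: tendsto_unique[OF at_neq_bot])
        ultimately have "b * l1 = b * l" using L(3) by (metis add_left_cancel)
        then have "b = 0" using l1(2) by simp
        with L(1) det show False by simp
      next
        fix l' assume "\<exists>\<^sub>F t in at 0. g (t ^ 1, l1 * t ^ q) ^ 1 = l' * f (t ^ 1, l1 * t ^ q) ^ q"
        from to_branch[OF this] L(1) det show False by simp
      qed
    qed
    from component[OF l0] not_axis[OF l0] to_branch[of l0]
    obtain L where c: "c = 0" and L: "((\<lambda>t. g (t ^ 1, 0) / t ^ q) \<longlongrightarrow> L) (at 0)" by auto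
    have ad: "a \<noteq> 0" "d \<noteq> 0" using det c by auto
    have branch: "\<exists>l'\<in>set ls'. L + d * l = l' * a ^ q" if l: "l \<in> set ls" for l
    proof -
      obtain l' where l': "l' \<in> set ls'"
        "\<exists>\<^sub>F t in at 0. g (t ^ 1, l * t ^ q) ^ 1 = l' * f (t ^ 1, l * t ^ q) ^ q"
        using component[OF l] not_axis[OF l] by auto
      from to_branch[OF l'(2)] obtain L' where
        "((\<lambda>t. g (t ^ 1, 0) / t ^ q) \<longlongrightarrow> L') (at 0)" "L' + d * l = l' * a ^ q" by blast
      \<comment> \<open>Uniqueness of the limit makes the translation part the same for every
        slope.\<close>
      moreover from this have "L' = L" using L by (auto intro: tendsto_unique[OF at_neq_bot])
      ultimately show ?thesis using l'(1) by auto
    qed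
    show ?thesis
    proof
      define \<alpha> \<beta> where "\<alpha> = d / a ^ q" and "\<beta> = L / a ^ q"
      have \<alpha>: "\<alpha> \<noteq> 0" using ad by (simp add: \<alpha>_def)
      then show "(\<lambda>z. \<alpha> * z + \<beta>) \<in> Aff" by (auto simp: Aff_def)
      show "set ls' = (\<lambda>z. \<alpha> * z + \<beta>) ` set ls"
      proof (rule conf_image_eq[OF ls ls'])
        show "(\<lambda>z. \<alpha> * z + \<beta>) ` set ls \<subseteq> set ls'"
        proof (rule image_subsetI)
          fix l assume "l \<in> set ls"
          with branch obtain l' where "l' \<in> set ls'" "L + d * l = l' * a ^ q" by blast
          moreover from this have "\<alpha> * l + \<beta> = l'"
            using ad by (simp add: \<alpha>_def \<beta>_def field_simps)
          ultimately show "\<alpha> * l + \<beta> \<in> set ls'" by simp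
        qed
      qed (use \<alpha> in \<open>auto simp: inj_on_def\<close>)
    qed
  qed
qed

end

section \<open>Lines\<close>

definition line_zeros :: "P1 list \<Rightarrow> (complex \<times> complex) set" where
  "line_zeros ls = {(x, y). (\<Prod>l\<leftarrow>ls. slope_form l x y) = 0}"

lemma line_zeros_iff: "(x, y) \<in> line_zeros ls \<longleftrightarrow> (\<exists>l\<in>set ls. slope_form l x y = 0)"
  by (auto simp: line_zeros_def prod_list_zero_iff)

lemma C_11_eq: "C_11 ls = germ0 (line_zeros ls)"
  by (simp add: C_11_def line_zeros_def)

text \<open>Slopes are quotients \<open>y / x\<close>, so the matrix acts with its entries in
  reversed order: \<open>(b * x + a * y) / (d * x + c * y)\<close> is the Moebius transform of
  \<open>y / x\<close>.\<close>

lemma slope_form_moebius: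
  assumes "a * d - b * c \<noteq> 0"
  shows "slope_form (moebius a b c d l) (d * x + c * y) (b * x + a * y) = 0 \<longleftrightarrow> slope_form l x y = 0"
proof (cases l)
  case (Fin z)
  show ?thesis
  proof (cases "c * z + d = 0")
    case True
    then have d: "d = - (c * z)" by (simp add: eq_neg_iff_add_eq_0 add.commute)
    then have "c \<noteq> 0" using assms by auto
    moreover have "d * x + c * y = c * (y - z * x)" by (simp add: d algebra_simps)
    ultimately show ?thesis using Fin True by simp
  next
    case False
    have "(b * x + a * y) - (a * z + b) / (c * z + d) * (d * x + c * y) =
        ((b * x + a * y) * (c * z + d) - (a * z + b) * (d * x + c * y)) / (c * z + d)"
      using False by (simp add: divide_simps)
    also have "\<dots> = (a * d - b * c) * (y - z * x) / (c * z + d)" by (simp add: algebra_simps)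
    finally show ?thesis using Fin False assms by simp
  qed
next
  case Infty
  show ?thesis
  proof (cases "c = 0")
    case True
    then show ?thesis using Infty assms by auto
  next
    case False
    have "(b * x + a * y) - a / c * (d * x + c * y) = - ((a * d - b * c) * x / c)"
      using False by (simp add: divide_simps) (simp add: algebra_simps)
    then show ?thesis using Infty False assms by simp
  qed
qed

lemma slope_form_inject:
  assumes "slope_form l x y = 0" "slope_form l' x y = 0" "x \<noteq> 0 \<or> y \<noteq> 0"
  shows "l = l'"
  using assms by (cases l; cases l') auto

text \<open>Dividing all entries by a square root of the determinant normalises it to 1 without
  changing the transformation.\<close>

lemma moebius_in_PSL2:
  assumes "a * d - b * c \<noteq> 0"
  shows "moebius a b c d \<in> PSL2"
proof -
  define s where "s = csqrt (a * d - b * c)"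
  have s: "s * s = a * d - b * c" unfolding s_def by (simp flip: power2_eq_square)
  then have s0: "s \<noteq> 0" using assms by auto
  have "moebius a b c d z = moebius (a / s) (b / s) (c / s) (d / s) z" for z
  proof (cases z)
    case (Fin w)
    have "a / s * w + b / s = (a * w + b) / s" "c / s * w + d / s = (c * w + d) / s"
      by (simp_all add: add_divide_distrib)
    then show ?thesis using Fin s0 by simp
  qed (use s0 in simp)
  moreover have "a / s * (d / s) - b / s * (c / s) = 1"
  proof -
    have "a / s * (d / s) - b / s * (c / s) = (a * d - b * c) / (s * s)"
      by (simp add: diff_divide_distrib)
    then show ?thesis using s s0 assms by simp
  qed
  ultimately show ?thesis unfolding PSL2_def by blast
qed

lemma inj_PSL2:
  assumes "h \<in> PSL2" shows "inj h"
proof -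
  obtain a b c d where *: "a * d - b * c = 1" "h = moebius a b c d"
    using assms by (auto simp: PSL2_def)
  have i: "d * a - (- b) * (- c) = 1" using *(1) by (simp add: algebra_simps)
  have "moebius d (- b) (- c) a (h z) = moebius 1 0 0 1 z" for z
    using * moebius_compose[OF i *(1)] by (simp add: algebra_simps)
  then show ?thesis by (intro inj_on_inverseI[of _ "moebius d (- b) (- c) a"]) (simp add: moebius_id)
qed

lemma has_derivative_radial_tendsto:
  fixes f :: "complex \<times> complex \<Rightarrow> complex"
  assumes "(f has_derivative (\<lambda>(u, v). a * u + b * v)) (at 0)" "f 0 = 0"
  shows "((\<lambda>t. f (t * x, t * y) / t) \<longlongrightarrow> a * x + b * y) (at 0)"
proof -
  have 1: "((\<lambda>t. (t * x, t * y)) has_derivative (\<lambda>t. (t * x, t * y))) (at 0)"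
    by (intro has_derivative_Pair bounded_linear_imp_has_derivative bounded_linear_mult_left)
  have "((\<lambda>t. f (t * x, t * y)) has_derivative (\<lambda>t. a * (t * x) + b * (t * y))) (at 0)"
    using has_derivative_compose[OF 1, of f "\<lambda>(u, v). a * u + b * v"] assms(1)
    by (simp add: zero_prod_def)
  then have "((\<lambda>t. f (t * x, t * y)) has_field_derivative (a * x + b * y)) (at 0)"
    unfolding has_field_derivative_def
    by (rule has_derivative_eq_rhs) (simp add: fun_eq_iff algebra_simps)
  then show ?thesis using assms(2) by (simp add: DERIV_def zero_prod_def)
qed

text \<open>Along a line, the image divided by \<open>t\<close> tends to the image of the direction
  vector under the derivative. Homogeneity of \<open>slope_form\<close> carries the vanishing over
  to the limit.\<close>

lemma (in biholo_germ) line_zeros_image: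
  assumes ls: "ls \<in> conf UNIV n" and ls': "ls' \<in> conf UNIV n"
    and ev: "\<forall>\<^sub>F z in nhds 0. z \<in> line_zeros ls \<longrightarrow> (f z, g z) \<in> line_zeros ls'"
  shows "\<exists>h\<in>PSL2. set ls' = h ` set ls"
proof
  have det': "d * a - c * b \<noteq> 0" using det by (simp add: mult.commute)
  \<comment> \<open>The vector \<open>(1, z)\<close> goes to \<open>(a + b * z, c + d * z)\<close>,
    of slope \<open>(d * z + c) / (b * z + a)\<close>.\<close>
  define h where "h = moebius d c b a"
  show h: "h \<in> PSL2" unfolding h_def using det' by (rule moebius_in_PSL2)
  show "set ls' = h ` set ls"
  proof (rule conf_image_eq[OF ls ls'])
    show "inj_on h (set ls)" using inj_PSL2[OF h] by (rule inj_on_subset) simp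
    show "h ` set ls \<subseteq> set ls'"
    proof (rule image_subsetI)
      fix l assume l: "l \<in> set ls"
      obtain x y where xy: "slope_form l x y = 0" "x \<noteq> 0 \<or> y \<noteq> 0"
      proof (cases l)
        case (Fin z)
        then show ?thesis using that[of 1 z] by simp
      next
        case Infty
        then show ?thesis using that[of 0 1] by simp
      qed
      have scale: "slope_form l' (t * u) (t * v) = t * slope_form l' u v" for l' t u v
        by (cases l') (simp_all add: algebra_simps)
      have "((\<lambda>t. (t * x, t * y)) \<longlongrightarrow> (0 * x, 0 * y)) (at 0)" by (intro tendsto_intros)
      then have "((\<lambda>t. (t * x, t * y)) \<longlongrightarrow> 0) (at 0)" by (simp add: zero_prod_def)
      then have "\<forall>\<^sub>F t in at 0. (t * x, t * y) \<in> line_zeros ls \<longrightarrow>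
          (f (t * x, t * y), g (t * x, t * y)) \<in> line_zeros ls'"
        using ev unfolding filterlim_iff by blast
      moreover have "(t * x, t * y) \<in> line_zeros ls" for t
        using l xy by (auto simp: line_zeros_iff scale)
      ultimately have "\<forall>\<^sub>F t in at 0. \<exists>l'\<in>set ls'. slope_form l' (f (t * x, t * y)) (g (t * x, t * y)) = 0"
        by (simp add: line_zeros_iff)
      then have "\<exists>\<^sub>F t in at 0. \<exists>l'\<in>set ls'. slope_form l' (f (t * x, t * y)) (g (t * x, t * y)) = 0"
        by (rule eventually_frequently[rotated]) simp
      then obtain l' where l': "l' \<in> set ls'"
        "\<exists>\<^sub>F t in at 0. slope_form l' (f (t * x, t * y)) (g (t * x, t * y)) = 0"
        by (auto simp: frequently_bex_finite_distrib)
      have lim: "((\<lambda>t. f (t * x, t * y) / t) \<longlongrightarrow> a * x + b * y) (at 0)"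
        "((\<lambda>t. g (t * x, t * y) / t) \<longlongrightarrow> c * x + d * y) (at 0)"
        by (rule has_derivative_radial_tendsto deriv zero)+
      have "slope_form l' (a * x + b * y) (c * x + d * y) = 0"
      proof (rule tendsto_unique_frequently_eq[OF _ tendsto_const])
        show "((\<lambda>t. slope_form l' (f (t * x, t * y) / t) (g (t * x, t * y) / t)) \<longlongrightarrow>
            slope_form l' (a * x + b * y) (c * x + d * y)) (at 0)"
          by (cases l') (auto intro!: tendsto_intros lim simp del: times_divide_eq_right)
        from l'(2) show "\<exists>\<^sub>F t in at 0. slope_form l' (f (t * x, t * y) / t) (g (t * x, t * y) / t) = 0"
        proof (rule frequently_elim1)
          fix t assume "slope_form l' (f (t * x, t * y)) (g (t * x, t * y)) = 0"
          then show "slope_form l' (f (t * x, t * y) / t) (g (t * x, t * y) / t) = 0"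
            using scale[of l' "inverse t"] by (simp add: divide_inverse mult.commute[of _ "inverse t"])
        qed
      qed
      moreover have "slope_form (h l) (a * x + b * y) (c * x + d * y) = 0"
        unfolding h_def using slope_form_moebius[OF det'] xy(1) by simp
      \<comment> \<open>A nonzero vector lies on only one line through the origin, which identifies
        \<open>l'\<close> with \<open>h l\<close>.\<close>
      moreover have "a * x + b * y \<noteq> 0 \<or> c * x + d * y \<noteq> 0"
      proof (rule ccontr)
        assume "\<not> ?thesis"
        then have "a * x + b * y = 0" "c * x + d * y = 0" by auto
        moreover have "(a * d - b * c) * x = d * (a * x + b * y) - b * (c * x + d * y)"
          "(a * d - b * c) * y = a * (c * x + d * y) - c * (a * x + b * y)"
          by (simp_all add: algebra_simps)
        ultimately show False using det xy(2) by simp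
      qed
      ultimately have "l' = h l" by (rule slope_form_inject)
      with l'(1) show "h l \<in> set ls'" by simp
    qed
  qed
qed

section \<open>The normal forms are curve germs, and the groups act by biholomorphisms\<close>

text \<open>The path \<open>\<gamma>\<close> approaches the origin off the zero set and so certifies
  that \<open>F\<close> is not the zero germ.\<close>

lemma zeros_in_curve_germs:
  assumes "holo2_on F UNIV" "F 0 = 0" "(\<gamma> \<longlongrightarrow> 0) (at (0 :: complex))" "\<And>t. t \<noteq> 0 \<Longrightarrow> F (\<gamma> t) \<noteq> 0"
  shows "germ0 {z. F z = 0} \<in> curve_germs"
proof -
  have "\<not> (\<forall>\<^sub>F z in nhds 0. F z = 0)"
  proof
    assume "\<forall>\<^sub>F z in nhds 0. F z = 0"
    then have "\<forall>\<^sub>F t in at 0. F (\<gamma> t) = 0" using assms(3) unfolding filterlim_iff by blast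
    moreover have "\<forall>\<^sub>F t in at (0 :: complex). t \<noteq> 0" by (simp add: eventually_at_filter)
    ultimately have "\<forall>\<^sub>F t in at (0 :: complex). False" by eventually_elim (use assms(4) in auto)
    then show False by simp
  qed
  then have "holo2_on F UNIV \<and> 0 \<in> UNIV \<and> F 0 = 0 \<and> \<not> (\<forall>\<^sub>F z in nhds 0. F z = 0)"
    using assms by simp
  then show ?thesis unfolding curve_germs_def by (intro CollectI exI[of _ F] exI[of _ UNIV]) simp
qed

lemma qh_zeros_in_curve_germs:
  assumes pq: "0 < p" "0 < q" and ls: "ls \<noteq> []"
  shows "germ0 (qh_zeros p q m k ls) \<in> curve_germs"
proof -
  define F where "F = (\<lambda>z :: complex \<times> complex. fst z ^ m * snd z ^ k * (\<Prod>l\<leftarrow>ls. snd z ^ p - l * fst z ^ q))"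
  have F: "{z. F z = 0} = qh_zeros p q m k ls" by (auto simp: F_def qh_zeros_def)
  obtain w where w: "w \<notin> insert 0 (set ls)"
    using ex_new_if_finite[OF infinite_UNIV_char_0, of "insert 0 (set ls)"] by auto
  obtain \<mu> where \<mu>: "\<mu> ^ p = w" using exists_complex_root[OF pq(1)] by blast
  have "germ0 {z. F z = 0} \<in> curve_germs"
  proof (rule zeros_in_curve_germs[OF _ _ branch_path_tendsto[OF pq, of \<mu>]])
    show "holo2_on F UNIV" unfolding F_def by (intro holo2_on_intros open_UNIV)
    have "0 \<in> {z. F z = 0}" unfolding F zero_prod_def qh_zeros_iff
      using ls pq by (auto simp: zero_power intro!: bexI[of _ "hd ls"])
    then show "F 0 = 0" by simp
    fix t :: complex assume t: "t \<noteq> 0"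
    have "(t ^ p, \<mu> * t ^ q) \<notin> qh_zeros p q m k ls"
    proof -
      have "\<mu> \<noteq> 0" using w \<mu> pq by (auto simp: zero_power)
      moreover have "(\<mu> * t ^ q) ^ p = w * (t ^ p) ^ q"
        by (simp add: \<mu> power_mult_distrib mult.commute flip: power_mult)
      ultimately show ?thesis using t w by (auto simp: qh_zeros_iff)
    qed
    then show "F (t ^ p, \<mu> * t ^ q) \<noteq> 0" unfolding F[symmetric] by simp
  qed
  then show ?thesis by (simp only: F)
qed

lemma line_zeros_in_curve_germs:
  assumes ls: "ls \<noteq> []"
  shows "germ0 (line_zeros ls) \<in> curve_germs"
proof -
  define F where "F = (\<lambda>z :: complex \<times> complex. \<Prod>l\<leftarrow>ls. slope_form l (fst z) (snd z))"
  have F: "{z. F z = 0} = line_zeros ls" by (auto simp: F_def line_zeros_def)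
  have "finite (Fin -` set ls)" by (intro finite_vimageI) (auto simp: inj_on_def)
  then obtain w where w: "Fin w \<notin> set ls"
    using ex_new_if_finite[OF infinite_UNIV_char_0, of "Fin -` set ls"] by auto
  have "germ0 {z. F z = 0} \<in> curve_germs"
  proof (rule zeros_in_curve_germs[OF _ _ branch_path_tendsto[OF zero_less_one zero_less_one, of w]])
    show "holo2_on F UNIV" unfolding F_def
    proof (rule holo2_on_prod_list[OF open_UNIV])
      fix l show "holo2_on (\<lambda>z. slope_form l (fst z) (snd z)) UNIV"
        by (cases l) (simp_all add: holo2_on_intros)
    qed
    have "slope_form l 0 0 = 0" for l by (cases l) auto
    then have "0 \<in> {z. F z = 0}" unfolding F zero_prod_def line_zeros_iff
      using ls by (intro bexI[of _ "hd ls"]) auto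
    then show "F 0 = 0" by simp
    fix t :: complex assume t: "t \<noteq> 0"
    have "slope_form l t (w * t) \<noteq> 0" if "l \<in> set ls" for l
      using w t that by (cases l) auto
    then have "(t ^ 1, w * t ^ 1) \<notin> line_zeros ls" by (auto simp: line_zeros_iff)
    then show "F (t ^ 1, w * t ^ 1) \<noteq> 0" unfolding F[symmetric] by simp
  qed
  then show ?thesis by (simp only: F)
qed

section \<open>Group elements realised by polynomial automorphisms of the plane\<close>

lemma germ_biholo_global:
  assumes "holo2_map_on \<Phi> UNIV" "holo2_map_on \<Psi> UNIV" "\<Phi> 0 = 0"
    and "\<And>z. \<Psi> (\<Phi> z) = z" "\<And>z. \<Phi> (\<Psi> z) = z" and mem: "\<And>z. \<Phi> z \<in> B \<longleftrightarrow> z \<in> A"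
  shows "germ_biholo (germ0 A) (germ0 B)"
proof -
  have "local_biholo \<Phi> UNIV UNIV" by (rule local_biholo_I[of _ _ _ \<Psi>]) (use assms in auto)
  moreover have "B = \<Phi> ` (A \<inter> UNIV)"
  proof (intro set_eqI iffI)
    fix w assume "w \<in> B"
    then have "\<Psi> w \<in> A" using mem[of "\<Psi> w"] assms(5) by simp
    then show "w \<in> \<Phi> ` (A \<inter> UNIV)" using assms(5)[of w] by (auto intro!: image_eqI[of _ _ "\<Psi> w"])
  qed (use mem in auto)
  ultimately show ?thesis unfolding germ_biholo_def by blast
qed

lemma germ_biholo_qh_zeros_GL1:
  assumes p: "0 < p" and "h \<in> GL1" "set ls' = h ` set ls"
  shows "germ_biholo (germ0 (qh_zeros p q m k ls)) (germ0 (qh_zeros p q m k ls'))"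
proof -
  obtain \<alpha> where \<alpha>: "\<alpha> \<noteq> 0" "h = (\<lambda>z. \<alpha> * z)" using assms by (auto simp: GL1_def)
  \<comment> \<open>Scaling \<open>y\<close> by a \<open>p\<close>-th root of
    \<open>\<alpha>\<close> multiplies every slope by \<open>\<alpha>\<close> and preserves both
    axes.\<close>
  obtain d where d: "d ^ p = \<alpha>" using exists_complex_root[OF p] by blast
  have d0: "d \<noteq> 0" using d \<alpha> p by (auto simp: zero_power)
  show ?thesis
  proof (rule germ_biholo_global[of "\<lambda>z. (fst z, d * snd z)" "\<lambda>z. (fst z, inverse d * snd z)"])
    fix z :: "complex \<times> complex"
    have "(d * y) ^ p = \<alpha> * l * x ^ q \<longleftrightarrow> y ^ p = l * x ^ q" for x y l
      using d \<alpha> by (simp add: power_mult_distrib)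
    then show "(fst z, d * snd z) \<in> qh_zeros p q m k ls' \<longleftrightarrow> z \<in> qh_zeros p q m k ls"
      using d0 by (cases z) (simp add: qh_zeros_iff assms(3) \<alpha>(2))
  qed (use d0 in \<open>auto simp: holo2_map_on_def zero_prod_def intro!: holo2_on_intros\<close>)
qed

lemma germ_biholo_qh_zeros_Aff:
  assumes q: "0 < q" and "h \<in> Aff" "set ls' = h ` set ls"
  shows "germ_biholo (germ0 (qh_zeros 1 q m 0 ls)) (germ0 (qh_zeros 1 q m 0 ls'))"
proof -
  obtain \<alpha> \<beta> where \<alpha>: "\<alpha> \<noteq> 0" "h = (\<lambda>z. \<alpha> * z + \<beta>)" using assms by (auto simp: Aff_def)
  show ?thesis
  \<comment> \<open>The shear by \<open>\<beta> * x ^ q\<close> translates all slopes and preserves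
    \<open>x = 0\<close>. It moves \<open>y = 0\<close>, in accordance with the exponent
    \<open>k = 0\<close>.\<close>
  proof (rule germ_biholo_global[of "\<lambda>z. (fst z, \<alpha> * snd z + \<beta> * fst z ^ q)"
        "\<lambda>z. (fst z, inverse \<alpha> * (snd z - \<beta> * fst z ^ q))"])
    fix z :: "complex \<times> complex"
    have "\<alpha> * y + \<beta> * x ^ q = (\<alpha> * l + \<beta>) * x ^ q \<longleftrightarrow> y = l * x ^ q" for x y l
      using \<alpha> by (simp add: distrib_right mult.assoc)
    then show "(fst z, \<alpha> * snd z + \<beta> * fst z ^ q) \<in> qh_zeros 1 q m 0 ls' \<longleftrightarrow> z \<in> qh_zeros 1 q m 0 ls"
      by (cases z) (simp add: qh_zeros_iff assms(3) \<alpha>(2))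
  qed (use \<alpha> q in \<open>auto simp: holo2_map_on_def zero_prod_def zero_power mult.assoc[symmetric] intro!: holo2_on_intros\<close>)
qed

lemma germ_biholo_line_zeros_PSL2:
  assumes "h \<in> PSL2" "set ls' = h ` set ls"
  shows "germ_biholo (germ0 (line_zeros ls)) (germ0 (line_zeros ls'))"
proof -
  obtain a b c d where *: "a * d - b * c = 1" "h = moebius a b c d"
    using assms by (auto simp: PSL2_def)
  have i: "(a * d - b * c) * x = x" for x using * by simp
  show ?thesis
  proof (rule germ_biholo_global[of "\<lambda>z. (d * fst z + c * snd z, b * fst z + a * snd z)"
        "\<lambda>z. (a * fst z - c * snd z, d * snd z - b * fst z)"])
    fix z :: "complex \<times> complex"
    show "(d * fst z + c * snd z, b * fst z + a * snd z) \<in> line_zeros ls' \<longleftrightarrow> z \<in> line_zeros ls"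
      using *(1) by (cases z) (simp add: line_zeros_iff assms(2) *(2) slope_form_moebius)
    obtain x y where z: "z = (x, y)" by (cases z)
    show "(a * fst (d * fst z + c * snd z, b * fst z + a * snd z) - c * snd (d * fst z + c * snd z, b * fst z + a * snd z),
        d * snd (d * fst z + c * snd z, b * fst z + a * snd z) - b * fst (d * fst z + c * snd z, b * fst z + a * snd z)) = z"
      using i[of x] i[of y] by (simp add: z algebra_simps)
    show "(d * fst (a * fst z - c * snd z, d * snd z - b * fst z) + c * snd (a * fst z - c * snd z, d * snd z - b * fst z),
        b * fst (a * fst z - c * snd z, d * snd z - b * fst z) + a * snd (a * fst z - c * snd z, d * snd z - b * fst z)) = z"
      using i[of x] i[of y] by (simp add: z algebra_simps)
  qed (auto simp: holo2_map_on_def zero_prod_def intro!: holo2_on_intros)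
qed

section \<open>Classification\<close>

lemma C_pq_biholo_iff:
  assumes pq: "2 \<le> p" "p < q" "coprime p q" and n: "1 \<le> n"
    and ls: "ls \<in> conf (- {0}) n" and ls': "ls' \<in> conf (- {0}) n"
    and mk: "m \<in> {0, 1}" "k \<in> {0, 1}" "m' \<in> {0, 1}" "k' \<in> {0, 1}"
  shows "germ_biholo (C_pq p q m k ls) (C_pq p q m' k' ls') \<longleftrightarrow>
    m = m' \<and> k = k' \<and> (\<exists>h\<in>GL1. set ls' = h ` set ls)"
proof
  assume *: "germ_biholo (C_pq p q m k ls) (C_pq p q m' k' ls')"
  have imp: "(m \<noteq> 0 \<longrightarrow> m' \<noteq> 0) \<and> (k \<noteq> 0 \<longrightarrow> k' \<noteq> 0) \<and> (\<exists>h\<in>GL1. set ls' = h ` set ls)"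
    if "ls \<in> conf (- {0}) n" "ls' \<in> conf (- {0}) n"
      "germ_biholo (C_pq p q m k ls) (C_pq p q m' k' ls')" for m k ls m' k' ls'
    using that(3) unfolding C_pq_eq
  proof (rule germ_biholo_germ0E)
    fix f g U a b c d
    assume "biholo_germ f g U a b c d"
    then interpret biholo_germ f g U a b c d .
    assume "\<forall>\<^sub>F z in nhds 0. z \<in> qh_zeros p q m k ls \<longrightarrow> (f z, g z) \<in> qh_zeros p q m' k' ls'"
    from qh_zeros_image_pq[OF pq n that(1,2) this] show ?thesis by blast
  qed
  \<comment> \<open>The germ and its inverse give implications in both directions, hence equal
    exponents within \<open>{0, 1}\<close>.\<close>
  from imp[OF ls ls' *] imp[OF ls' ls germ_biholo_sym[OF *]] mk
  show "m = m' \<and> k = k' \<and> (\<exists>h\<in>GL1. set ls' = h ` set ls)" by auto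
next
  assume "m = m' \<and> k = k' \<and> (\<exists>h\<in>GL1. set ls' = h ` set ls)"
  then show "germ_biholo (C_pq p q m k ls) (C_pq p q m' k' ls')"
    unfolding C_pq_eq using germ_biholo_qh_zeros_GL1 pq(1) by auto
qed

lemma C_1q_biholo_iff:
  assumes q: "1 < q" and n: "1 \<le> n"
    and ls: "ls \<in> conf UNIV n" and ls': "ls' \<in> conf UNIV n"
    and m: "m \<in> {0, 1}" "m' \<in> {0, 1}"
  shows "germ_biholo (C_1q q m ls) (C_1q q m' ls') \<longleftrightarrow> m = m' \<and> (\<exists>h\<in>Aff. set ls' = h ` set ls)"
proof
  assume *: "germ_biholo (C_1q q m ls) (C_1q q m' ls')"
  have imp: "(m \<noteq> 0 \<longrightarrow> m' \<noteq> 0) \<and> (\<exists>h\<in>Aff. set ls' = h ` set ls)"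
    if "ls \<in> conf UNIV n" "ls' \<in> conf UNIV n"
      "germ_biholo (C_1q q m ls) (C_1q q m' ls')" for m ls m' ls'
    using that(3) unfolding C_1q_eq
  proof (rule germ_biholo_germ0E)
    fix f g U a b c d
    assume "biholo_germ f g U a b c d"
    then interpret biholo_germ f g U a b c d .
    assume "\<forall>\<^sub>F z in nhds 0. z \<in> qh_zeros 1 q m 0 ls \<longrightarrow> (f z, g z) \<in> qh_zeros 1 q m' 0 ls'"
    from qh_zeros_image_1q[OF q n that(1,2) this] show ?thesis by blast
  qed
  from imp[OF ls ls' *] imp[OF ls' ls germ_biholo_sym[OF *]] m
  show "m = m' \<and> (\<exists>h\<in>Aff. set ls' = h ` set ls)" by auto
next
  assume "m = m' \<and> (\<exists>h\<in>Aff. set ls' = h ` set ls)"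
  then show "germ_biholo (C_1q q m ls) (C_1q q m' ls')"
    unfolding C_1q_eq using germ_biholo_qh_zeros_Aff q by auto
qed

lemma C_11_biholo_iff:
  assumes ls: "ls \<in> conf UNIV n" and ls': "ls' \<in> conf UNIV n"
  shows "germ_biholo (C_11 ls) (C_11 ls') \<longleftrightarrow> (\<exists>h\<in>PSL2. set ls' = h ` set ls)"
proof
  assume "germ_biholo (C_11 ls) (C_11 ls')"
  then show "\<exists>h\<in>PSL2. set ls' = h ` set ls"
    unfolding C_11_eq
  proof (rule germ_biholo_germ0E)
    fix f g U a b c d
    assume "biholo_germ f g U a b c d"
    then interpret biholo_germ f g U a b c d .
    assume "\<forall>\<^sub>F z in nhds 0. z \<in> line_zeros ls \<longrightarrow> (f z, g z) \<in> line_zeros ls'"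
    then show ?thesis by (rule line_zeros_image[OF ls ls'])
  qed
next
  assume "\<exists>h\<in>PSL2. set ls' = h ` set ls"
  then show "germ_biholo (C_11 ls) (C_11 ls')"
    unfolding C_11_eq using germ_biholo_line_zeros_PSL2 by blast
qed

text \<open>A tuple of distinct entries is determined up to permutation by its set of entries. The
  two nested quotients thus reduce to one group action on finite sets.\<close>

lemma conf_class_eq_iff:
  assumes eq: "equiv (Symm M n) (orbit_rel G M n)"
    and G: "\<And>h z. h \<in> G \<Longrightarrow> z \<in> M \<Longrightarrow> h z \<in> M" "\<And>h. h \<in> G \<Longrightarrow> inj_on h M"
    and xs: "xs \<in> conf M n" and ys: "ys \<in> conf M n"
  shows "conf_class G M n xs = conf_class G M n ys \<longleftrightarrow> (\<exists>h\<in>G. set ys = h ` set xs)"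
proof -
  have S: "perm_rel M n `` {xs} \<in> Symm M n" "perm_rel M n `` {ys} \<in> Symm M n"
    using xs ys by (auto simp: Symm_def intro: quotientI)
  have "conf_class G M n xs = conf_class G M n ys \<longleftrightarrow>
      (perm_rel M n `` {xs}, perm_rel M n `` {ys}) \<in> orbit_rel G M n"
    unfolding conf_class_def using eq_equiv_class_iff[OF eq S] .
  also have "\<dots> \<longleftrightarrow> (\<exists>h\<in>G. perm_rel M n `` {ys} = map h ` (perm_rel M n `` {xs}))"
    using S by (simp add: orbit_rel_def)
  also have "\<dots> \<longleftrightarrow> (\<exists>h\<in>G. set ys = h ` set xs)"
  proof (rule bex_cong[OF refl])
    fix h assume h: "h \<in> G"
    have hx: "map h xs \<in> conf M n" "map h ` (perm_rel M n `` {xs}) = perm_rel M n `` {map h xs}"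
      using map_image_perm_class[of M h xs n] G h xs by auto
    have "perm_rel M n `` {ys} = perm_rel M n `` {map h xs} \<longleftrightarrow> (ys, map h xs) \<in> perm_rel M n"
      by (rule eq_equiv_class_iff[OF equiv_perm_rel ys hx(1)])
    then show "perm_rel M n `` {ys} = map h ` (perm_rel M n `` {xs}) \<longleftrightarrow> set ys = h ` set xs"
      using hx ys by (simp add: perm_rel_altdef)
  qed
  finally show ?thesis .
qed

section \<open>From equivalence criteria to bijections of quotients\<close>

lemma Symm_quot_eq: "Symm_quot G M n = conf_class G M n ` conf M n"
  by (auto simp: Symm_quot_def Symm_def quotient_def conf_class_def)

text \<open>The parameter class \<open>r\<close> and the analytic class of \<open>c\<close> identify
  the same parameters, so each factors through the other. Surjectivity holds because every germ in
  \<open>Q\<close> is equivalent to a normal form.\<close>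

lemma moduli_bij:
  assumes c: "\<And>x. x \<in> X \<Longrightarrow> c x \<in> curve_germs"
    and Q: "Q = {C \<in> curve_germs. \<exists>x\<in>X. germ_biholo C (c x)}"
    and r: "\<And>x y. x \<in> X \<Longrightarrow> y \<in> X \<Longrightarrow> r x = r y \<longleftrightarrow> germ_biholo (c x) (c y)"
  shows "\<exists>F. bij_betw F (r ` X) (Q // analytic_equiv) \<and> (\<forall>x\<in>X. F (r x) = analytic_class (c x))"
proof -
  define k where "k = (\<lambda>x. analytic_class (c x))"
  have class_eq: "analytic_class C = analytic_class C' \<longleftrightarrow> germ_biholo C C'"
    if "C \<in> curve_germs" "C' \<in> curve_germs" for C C'
    using eq_equiv_class_iff[OF equiv_analytic_equiv that] that by (simp add: analytic_equiv_def)
  have rk: "r x = r y \<longleftrightarrow> k x = k y" if "x \<in> X" "y \<in> X" for x y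
    using r[OF that] class_eq c that by (simp add: k_def)
  have Q_eq: "Q // analytic_equiv = k ` X"
  proof (intro set_eqI iffI)
    fix K assume "K \<in> Q // analytic_equiv"
    then obtain C where "C \<in> Q" "K = analytic_class C" by (auto simp: quotient_def)
    then show "K \<in> k ` X" using class_eq c by (auto simp: Q k_def)
  next
    fix K assume "K \<in> k ` X"
    then obtain x where x: "x \<in> X" "K = analytic_class (c x)" by (auto simp: k_def)
    then have "c x \<in> Q" using c class_eq by (auto simp: Q)
    then show "K \<in> Q // analytic_equiv" using x by (auto intro: quotientI)
  qed
  \<comment> \<open>By \<open>rk\<close>, the value is independent of the representative
    chosen.\<close>
  define F where "F = (\<lambda>s. k (SOME x. x \<in> X \<and> r x = s))"
  have F: "F (r x) = k x" if "x \<in> X" for x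
  proof -
    define y where "y = (SOME y. y \<in> X \<and> r y = r x)"
    have "y \<in> X \<and> r y = r x" unfolding y_def by (rule someI[of _ x]) (use that in simp)
    then have "k y = k x" using rk[of y x] that by simp
    then show ?thesis by (simp add: F_def y_def)
  qed
  have "bij_betw F (r ` X) (k ` X)"
    unfolding bij_betw_def inj_on_def using F rk by (auto simp: image_image)
  then show ?thesis using F Q_eq by (intro exI[of _ F]) (simp add: k_def)
qed

lemma image_Times_snd: "(\<lambda>(a, x). (a, f x)) ` (A \<times> B) = A \<times> f ` B"
  by force

lemma image_Times_snd_snd: "(\<lambda>(a, b, x). (a, b, f x)) ` (A \<times> B \<times> C) = A \<times> B \<times> f ` C"
  by force

lemma conf_nonempty: "xs \<in> conf M n \<Longrightarrow> 1 \<le> n \<Longrightarrow> xs \<noteq> []"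
  by (auto simp: conf_def)

theorem theorem1:
  fixes p q n :: nat
  assumes "1 \<le> p" and "p \<le> q" and "coprime p q" and "1 \<le> n"
  shows
    "(p = 1 \<and> q = 1 \<longrightarrow>
        (\<exists>F. bij_betw F (Symm_quot PSL2 UNIV n) (qh_moduli p q n) \<and>
             (\<forall>ls \<in> conf UNIV n.
                F (conf_class PSL2 UNIV n ls) = analytic_class (C_11 ls)))) \<and>
     (p = 1 \<and> 1 < q \<longrightarrow>
        (\<exists>F. bij_betw F ({0, 1} \<times> Symm_quot Aff UNIV n) (qh_moduli p q n) \<and>
             (\<forall>m \<in> {0, 1}. \<forall>ls \<in> conf UNIV n.
                F (m, conf_class Aff UNIV n ls) = analytic_class (C_1q q m ls)))) \<and>
     (1 < p \<and> p < q \<longrightarrow>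
        (\<exists>F. bij_betw F ({0, 1} \<times> {0, 1} \<times> Symm_quot GL1 (- {0}) n) (qh_moduli p q n) \<and>
             (\<forall>m \<in> {0, 1}. \<forall>k \<in> {0, 1}. \<forall>ls \<in> conf (- {0}) n.
                F (m, k, conf_class GL1 (- {0}) n ls) = analytic_class (C_pq p q m k ls))))"
proof (intro conjI impI)
  assume pq: "p = 1 \<and> q = 1"
  have "\<exists>F. bij_betw F (conf_class PSL2 UNIV n ` conf UNIV n) (qh_curves p q n // analytic_equiv) \<and>
      (\<forall>ls\<in>conf UNIV n. F (conf_class PSL2 UNIV n ls) = analytic_class (C_11 ls))"
  proof (rule moduli_bij)
    fix ls :: "P1 list" assume "ls \<in> conf UNIV n"
    from conf_nonempty[OF this assms(4)] show "C_11 ls \<in> curve_germs"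
      unfolding C_11_eq by (rule line_zeros_in_curve_germs)
  next
    show "qh_curves p q n = {C \<in> curve_germs. \<exists>ls\<in>conf UNIV n. germ_biholo C (C_11 ls)}"
      using pq by (simp add: qh_curves_def)
  next
    fix ls ls' :: "P1 list" assume "ls \<in> conf UNIV n" "ls' \<in> conf UNIV n"
    then show "conf_class PSL2 UNIV n ls = conf_class PSL2 UNIV n ls' \<longleftrightarrow>
        germ_biholo (C_11 ls) (C_11 ls')"
      by (simp add: C_11_biholo_iff conf_class_eq_iff[OF equiv_orbit_rel_PSL2] inj_PSL2)
  qed
  then show "\<exists>F. bij_betw F (Symm_quot PSL2 UNIV n) (qh_moduli p q n) \<and>
      (\<forall>ls\<in>conf UNIV n. F (conf_class PSL2 UNIV n ls) = analytic_class (C_11 ls))"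
    by (simp only: Symm_quot_eq qh_moduli_def)
next
  assume pq: "p = 1 \<and> 1 < q"
  \<comment> \<open>Exponent and configuration form one parameter for \<open>moduli_bij\<close>; the
    quotient leaves the exponent untouched, so the image of \<open>r\<close> is a product.\<close>
  define X where "X = {0, 1 :: nat} \<times> conf (UNIV :: complex set) n"
  define r where "r = (\<lambda>(m :: nat, ls). (m, conf_class Aff UNIV n ls))"
  define c where "c = (\<lambda>(m, ls). C_1q q m ls)"
  have inj: "inj h" if "h \<in> Aff" for h using that by (auto simp: Aff_def inj_on_def)
  have "\<exists>F. bij_betw F (r ` X) (qh_curves p q n // analytic_equiv) \<and>
      (\<forall>x\<in>X. F (r x) = analytic_class (c x))"
  proof (rule moduli_bij)
    fix x assume "x \<in> X"
    then show "c x \<in> curve_germs"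
      unfolding X_def c_def C_1q_eq split_def using pq
      by (intro qh_zeros_in_curve_germs) (auto dest: conf_nonempty[OF _ assms(4)])
  next
    show "qh_curves p q n = {C \<in> curve_germs. \<exists>x\<in>X. germ_biholo C (c x)}"
      using pq by (auto simp: qh_curves_def X_def c_def)
  next
    fix x y assume "x \<in> X" "y \<in> X"
    then obtain m ls m' ls' where xy: "x = (m, ls)" "y = (m', ls')" "m \<in> {0, 1}" "m' \<in> {0, 1}"
      "ls \<in> conf UNIV n" "ls' \<in> conf UNIV n" by (auto simp: X_def)
    have "conf_class Aff UNIV n ls = conf_class Aff UNIV n ls' \<longleftrightarrow> (\<exists>h\<in>Aff. set ls' = h ` set ls)"
      by (rule conf_class_eq_iff[OF equiv_orbit_rel_Aff]) (use xy inj in auto)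
    moreover have "germ_biholo (C_1q q m ls) (C_1q q m' ls') \<longleftrightarrow>
        m = m' \<and> (\<exists>h\<in>Aff. set ls' = h ` set ls)"
      by (rule C_1q_biholo_iff[OF _ assms(4)]) (use pq xy in auto)
    ultimately show "r x = r y \<longleftrightarrow> germ_biholo (c x) (c y)" using xy by (simp add: r_def c_def)
  qed
  moreover have "r ` X = {0, 1} \<times> Symm_quot Aff UNIV n"
    unfolding Symm_quot_eq X_def r_def by (rule image_Times_snd)
  ultimately show "\<exists>F. bij_betw F ({0, 1} \<times> Symm_quot Aff UNIV n) (qh_moduli p q n) \<and>
      (\<forall>m\<in>{0, 1}. \<forall>ls\<in>conf UNIV n. F (m, conf_class Aff UNIV n ls) = analytic_class (C_1q q m ls))"
    by (simp add: X_def r_def c_def qh_moduli_def)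
next
  assume pq: "1 < p \<and> p < q"
  define X where "X = {0, 1 :: nat} \<times> {0, 1 :: nat} \<times> conf (- {0 :: complex}) n"
  define r where "r = (\<lambda>(m :: nat, k :: nat, ls). (m, k, conf_class GL1 (- {0}) n ls))"
  define c where "c = (\<lambda>(m, k, ls). C_pq p q m k ls)"
  have inj: "inj_on h A" if "h \<in> GL1" for h A using that by (auto simp: GL1_def inj_on_def)
  have "\<exists>F. bij_betw F (r ` X) (qh_curves p q n // analytic_equiv) \<and>
      (\<forall>x\<in>X. F (r x) = analytic_class (c x))"
  proof (rule moduli_bij)
    fix x assume "x \<in> X"
    then show "c x \<in> curve_germs"
      unfolding X_def c_def C_pq_eq split_def using pq
      by (intro qh_zeros_in_curve_germs) (auto dest: conf_nonempty[OF _ assms(4)])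
  next
    show "qh_curves p q n = {C \<in> curve_germs. \<exists>x\<in>X. germ_biholo C (c x)}"
      using pq assms(3) by (auto simp: qh_curves_def X_def c_def)
  next
    fix x y assume "x \<in> X" "y \<in> X"
    then obtain m k ls m' k' ls' where xy: "x = (m, k, ls)" "y = (m', k', ls')"
      "m \<in> {0, 1}" "k \<in> {0, 1}" "m' \<in> {0, 1}" "k' \<in> {0, 1}"
      "ls \<in> conf (- {0}) n" "ls' \<in> conf (- {0}) n" by (auto simp: X_def)
    have "conf_class GL1 (- {0}) n ls = conf_class GL1 (- {0}) n ls' \<longleftrightarrow>
        (\<exists>h\<in>GL1. set ls' = h ` set ls)"
      by (rule conf_class_eq_iff[OF equiv_orbit_rel_GL1]) (use xy inj in \<open>auto simp: GL1_def\<close>)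
    moreover have "germ_biholo (C_pq p q m k ls) (C_pq p q m' k' ls') \<longleftrightarrow>
        m = m' \<and> k = k' \<and> (\<exists>h\<in>GL1. set ls' = h ` set ls)"
      by (rule C_pq_biholo_iff[OF _ _ assms(3,4)]) (use pq xy in auto)
    ultimately show "r x = r y \<longleftrightarrow> germ_biholo (c x) (c y)" using xy by (simp add: r_def c_def)
  qed
  moreover have "r ` X = {0, 1} \<times> {0, 1} \<times> Symm_quot GL1 (- {0}) n"
    unfolding Symm_quot_eq X_def r_def by (rule image_Times_snd_snd)
  ultimately show "\<exists>F. bij_betw F ({0, 1} \<times> {0, 1} \<times> Symm_quot GL1 (- {0}) n) (qh_moduli p q n) \<and>
      (\<forall>m\<in>{0, 1}. \<forall>k\<in>{0, 1}. \<forall>ls\<in>conf (- {0}) n.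
         F (m, k, conf_class GL1 (- {0}) n ls) = analytic_class (C_pq p q m k ls))"
    by (simp add: X_def r_def c_def qh_moduli_def)
qed

end
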